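(* Let $A$ be a closed, densely defined $G$-symmetric operator in $\mathcal H$ and let $0\notin\sigma_{\rm p}(G)$. If $\lambda\in\sigma_{\pi_+}(A)\cap\mathbb R$ (resp. $\lambda\in\sigma_{\pi_-}(A)\cap\mathbb R$), then there is a $G$-symmetric and bounded finite rank operator $F$ such that $$\lambda\in\sigma_+(A+F)\cup \mathrm r(A+F)\quad(\text{resp. }\lambda\in\sigma_-(A+F)\cup \mathrm r(A+F))$$ and $$\dim\operatorname{ran}(F)=\kappa_{-,0}(\ker(A-\lambda))\quad(\text{resp. }\dim\operatorname{ran}(F)=\kappa_{+,0}(\ker(A-\lambda))).$$
   Context: $(\mathcal H,(\cdot,\cdot))$ is a Hilbert space, $G$ is a bounded selfadjoint operator in $\mathcal H$, and $[x,y]:=(Gx,y)$. $\sigma_{\rm p}(G)$ is the set of eigenvalues of $G$. A linear operator $T$ in $\mathcal H$ is $G$-symmetric if $[Tx,y]=[x,Ty]$ for all $x,y\in\operatorname{dom}T$. "Subspace" means closed linear manifold. For a closed, densely defined operator $A$, $\sigma_{ap}(A)$ is the set of all $\lambda\in\mathbb C$ for which there is a sequence $(x_n)$ in $\operatorname{dom}A$ with $\|x_n\|=1$ and $(A-\lambda)x_n\to0$; $\mathrm r(A):=\mathbb C\setminus\sigma_{ap}(A)$. A point $\lambda\in\sigma_{ap}(A)$ belongs to $\sigma_{\pi_+}(A)$ (resp. $\sigma_{\pi_-}(A)$) if there is a linear manifold $\mathcal H_\lambda\subset\mathcal H$ with $\dim(\mathcal H/\mathcal H_\lambda)<\infty$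 such that for every sequence $(x_n)$ in $\mathcal H_\lambda\cap\operatorname{dom}A$ with $\|x_n\|=1$ and $(A-\lambda)x_n\to0$ one has $\liminf_n[x_n,x_n]>0$ (resp. $\limsup_n[x_n,x_n]<0$); it belongs to $\sigma_+(A)$ (resp. $\sigma_-(A)$) if $\mathcal H_\lambda$ can be chosen as $\mathcal H$. A fundamental decomposition of a subspace $\mathcal L$ is a direct, $[\cdot,\cdot]$-orthogonal sum $\mathcal L=\mathcal L_+[\dotplus]\mathcal L_-[\dotplus]\mathcal L^\circ$, where $\mathcal L_+$ is a subspace with $[x,x]>0$ for all nonzero $x\in\mathcal L_+$, $\mathcal L_-$ is a subspace with $[x,x]<0$ for all nonzero $x\in\mathcal L_-$, $\mathcal L^\circ=\{x\in\mathcal L:[x,y]=0\ \forall y\in\mathcal L\}$, and the corresponding projections in $\mathcal L$ are bounded. It always exists, and $\kappa_\pm(\mathcal L):=\dim\mathcal L_\pm$ and $\kappa_0(\mathcal L):=\dim\mathcal L^\circ$ are independent of its choice. $\kappa_{\pm,0}(\mathcal L):=\kappa_\pm(\mathcal L)+\kappa_0(\mathcal L)$. *)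

theory Defs
  imports "HOL-Analysis.Analysis" "HOL-Library.Extended_Nat"
begin

class complex_vector = real_vector +
  fixes scaleC :: "complex \<Rightarrow> 'a \<Rightarrow> 'a"  (infixr "*\<^sub>C" 75)
  assumes scaleC_add_right: "a *\<^sub>C (x + y) = a *\<^sub>C x + a *\<^sub>C y"
    and scaleC_add_left: "(a + b) *\<^sub>C x = a *\<^sub>C x + b *\<^sub>C x"
    and scaleC_scaleC: "a *\<^sub>C (b *\<^sub>C x) = (a * b) *\<^sub>C x"
    and scaleR_scaleC: "r *\<^sub>R x = complex_of_real r *\<^sub>C x"

text \<open>The inner product is linear in the first argument. The last axiom says that it is positive
  definite and that it induces the given norm.\<close>

class complex_inner = complex_vector + real_normed_vector +
  fixes cinner :: "'a \<Rightarrow> 'a \<Rightarrow> complex"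
  assumes cinner_commute: "cinner x y = cnj (cinner y x)"
    and cinner_add_left: "cinner (x + y) z = cinner x z + cinner y z"
    and cinner_scaleC_left: "cinner (c *\<^sub>C x) y = c * cinner x y"
    and cinner_self: "cinner x x = complex_of_real ((norm x)\<^sup>2)"

class complex_hilbert = complex_inner + complete_space

global_interpretation complex_vector:
  vector_space "scaleC :: complex \<Rightarrow> 'a \<Rightarrow> 'a::complex_vector"
  defines csubspace = complex_vector.subspace
    and cspan = complex_vector.span
proof
  fix a b :: complex and x y :: 'a
  show "a *\<^sub>C (x + y) = a *\<^sub>C x + a *\<^sub>C y" by (rule scaleC_add_right)
  show "(a + b) *\<^sub>C x = a *\<^sub>C x + b *\<^sub>C x" by (rule scaleC_add_left)
  show "a *\<^sub>C b *\<^sub>C x = (a * b) *\<^sub>C x" by (rule scaleC_scaleC)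
  show "1 *\<^sub>C x = x" using scaleR_scaleC[of 1 x] by simp
qed

text \<open>The library dimension is \<open>0\<close> on infinite-dimensional spaces, hence the version with
  values in \<^typ>\<open>enat\<close>.\<close>

definition cdim :: "'a::complex_vector set \<Rightarrow> enat" where
  "cdim V = (if \<exists>B. finite B \<and> V \<subseteq> cspan B then enat (complex_vector.dim V) else \<infinity>)"

text \<open>\<open>dim (H / M) < \<infinity>\<close>: the quotient is spanned by the cosets of finitely many vectors.\<close>

definition finite_codim :: "'a::complex_vector set \<Rightarrow> bool" where
  "finite_codim M \<longleftrightarrow> (\<exists>B. finite B \<and> cspan (M \<union> B) = UNIV)"

text \<open>An operator \<open>T\<close> with domain \<open>D\<close> is given by the set \<open>D\<close> and a total function whose values
  outside \<open>D\<close> are irrelevant.\<close>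

definition linear_operator :: "'a::complex_vector set \<Rightarrow> ('a \<Rightarrow> 'a) \<Rightarrow> bool" where
  "linear_operator D T \<longleftrightarrow> csubspace D \<and>
     (\<forall>x\<in>D. \<forall>y\<in>D. T (x + y) = T x + T y) \<and> (\<forall>c. \<forall>x\<in>D. T (c *\<^sub>C x) = c *\<^sub>C T x)"

definition closed_operator :: "'a::complex_inner set \<Rightarrow> ('a \<Rightarrow> 'a) \<Rightarrow> bool" where
  "closed_operator D T \<longleftrightarrow> linear_operator D T \<and> closed {(x, T x) | x. x \<in> D}"

definition densely_defined :: "'a::complex_inner set \<Rightarrow> bool" where
  "densely_defined D \<longleftrightarrow> closure D = UNIV"

definition bounded_clinear :: "('a::complex_inner \<Rightarrow> 'a) \<Rightarrow> bool" where
  "bounded_clinear T \<longleftrightarrow> bounded_linear T \<and> (\<forall>c x. T (c *\<^sub>C x) = c *\<^sub>C T x)"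

definition selfadjoint :: "('a::complex_inner \<Rightarrow> 'a) \<Rightarrow> bool" where
  "selfadjoint T \<longleftrightarrow> (\<forall>x y. cinner (T x) y = cinner x (T y))"

definition finite_rank :: "('a::complex_inner \<Rightarrow> 'a) \<Rightarrow> bool" where
  "finite_rank T \<longleftrightarrow> cdim (range T) < \<infinity>"

definition eigenspace :: "'a::complex_vector set \<Rightarrow> ('a \<Rightarrow> 'a) \<Rightarrow> complex \<Rightarrow> 'a set" where
  "eigenspace D T \<mu> = {x \<in> D. T x - \<mu> *\<^sub>C x = 0}"

definition sigma_p :: "'a::complex_vector set \<Rightarrow> ('a \<Rightarrow> 'a) \<Rightarrow> complex set" where
  "sigma_p D T = {\<mu>. \<exists>x\<in>D. x \<noteq> 0 \<and> T x = \<mu> *\<^sub>C x}"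

definition gform :: "('a::complex_inner \<Rightarrow> 'a) \<Rightarrow> 'a \<Rightarrow> 'a \<Rightarrow> complex" where
  "gform G x y = cinner (G x) y"

definition G_symmetric ::
  "('a::complex_inner \<Rightarrow> 'a) \<Rightarrow> 'a set \<Rightarrow> ('a \<Rightarrow> 'a) \<Rightarrow> bool" where
  "G_symmetric G D T \<longleftrightarrow> (\<forall>x\<in>D. \<forall>y\<in>D. gform G (T x) y = gform G x (T y))"

definition approx_eigenseq ::
  "'a::complex_inner set \<Rightarrow> ('a \<Rightarrow> 'a) \<Rightarrow> complex \<Rightarrow> (nat \<Rightarrow> 'a) \<Rightarrow> bool" where
  "approx_eigenseq D T \<mu> x \<longleftrightarrow> (\<forall>n. x n \<in> D \<and> norm (x n) = 1) \<and>
     (\<lambda>n. T (x n) - \<mu> *\<^sub>C x n) \<longlonglongrightarrow> 0"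

definition sigma_ap :: "'a::complex_inner set \<Rightarrow> ('a \<Rightarrow> 'a) \<Rightarrow> complex set" where
  "sigma_ap D T = {\<mu>. \<exists>x. approx_eigenseq D T \<mu> x}"

definition reg_points :: "'a::complex_inner set \<Rightarrow> ('a \<Rightarrow> 'a) \<Rightarrow> complex set" where
  "reg_points D T = UNIV - sigma_ap D T"

text \<open>For selfadjoint \<open>G\<close> the numbers \<open>[x, x]\<close> are real; \<^const>\<open>Re\<close> below only changes the type.\<close>

definition pos_type_on ::
  "('a::complex_inner \<Rightarrow> 'a) \<Rightarrow> 'a set \<Rightarrow> ('a \<Rightarrow> 'a) \<Rightarrow> complex \<Rightarrow> 'a set \<Rightarrow> bool" where
  "pos_type_on G D T \<mu> M \<longleftrightarrow> (\<forall>x. approx_eigenseq D T \<mu> x \<and> range x \<subseteq> M \<longrightarrow>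
     liminf (\<lambda>n. ereal (Re (gform G (x n) (x n)))) > 0)"

definition neg_type_on ::
  "('a::complex_inner \<Rightarrow> 'a) \<Rightarrow> 'a set \<Rightarrow> ('a \<Rightarrow> 'a) \<Rightarrow> complex \<Rightarrow> 'a set \<Rightarrow> bool" where
  "neg_type_on G D T \<mu> M \<longleftrightarrow> (\<forall>x. approx_eigenseq D T \<mu> x \<and> range x \<subseteq> M \<longrightarrow>
     limsup (\<lambda>n. ereal (Re (gform G (x n) (x n)))) < 0)"

definition sigma_pi_plus ::
  "('a::complex_inner \<Rightarrow> 'a) \<Rightarrow> 'a set \<Rightarrow> ('a \<Rightarrow> 'a) \<Rightarrow> complex set" where
  "sigma_pi_plus G D T =
     {\<mu> \<in> sigma_ap D T. \<exists>M. csubspace M \<and> finite_codim M \<and> pos_type_on G D T \<mu> M}"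

definition sigma_pi_minus ::
  "('a::complex_inner \<Rightarrow> 'a) \<Rightarrow> 'a set \<Rightarrow> ('a \<Rightarrow> 'a) \<Rightarrow> complex set" where
  "sigma_pi_minus G D T =
     {\<mu> \<in> sigma_ap D T. \<exists>M. csubspace M \<and> finite_codim M \<and> neg_type_on G D T \<mu> M}"

definition sigma_plus ::
  "('a::complex_inner \<Rightarrow> 'a) \<Rightarrow> 'a set \<Rightarrow> ('a \<Rightarrow> 'a) \<Rightarrow> complex set" where
  "sigma_plus G D T = {\<mu> \<in> sigma_ap D T. pos_type_on G D T \<mu> UNIV}"

definition sigma_minus ::
  "('a::complex_inner \<Rightarrow> 'a) \<Rightarrow> 'a set \<Rightarrow> ('a \<Rightarrow> 'a) \<Rightarrow> complex set" where
  "sigma_minus G D T = {\<mu> \<in> sigma_ap D T. neg_type_on G D T \<mu> UNIV}"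

definition isotropic_part :: "('a::complex_inner \<Rightarrow> 'a) \<Rightarrow> 'a set \<Rightarrow> 'a set" where
  "isotropic_part G L = {x \<in> L. \<forall>y\<in>L. gform G x y = 0}"

definition positive_subspace :: "('a::complex_inner \<Rightarrow> 'a) \<Rightarrow> 'a set \<Rightarrow> bool" where
  "positive_subspace G L \<longleftrightarrow> csubspace L \<and> closed L \<and>
     (\<forall>x\<in>L. x \<noteq> 0 \<longrightarrow> Re (gform G x x) > 0)"

definition negative_subspace :: "('a::complex_inner \<Rightarrow> 'a) \<Rightarrow> 'a set \<Rightarrow> bool" where
  "negative_subspace G L \<longleftrightarrow> csubspace L \<and> closed L \<and>
     (\<forall>x\<in>L. x \<noteq> 0 \<longrightarrow> Re (gform G x x) < 0)"

definition G_orthogonal :: "('a::complex_inner \<Rightarrow> 'a) \<Rightarrow> 'a set \<Rightarrow> 'a set \<Rightarrow> bool" where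
  "G_orthogonal G M N \<longleftrightarrow> (\<forall>x\<in>M. \<forall>y\<in>N. gform G x y = 0)"

text \<open>The projections of the decomposition map \<open>u + v + w\<close> to \<open>u\<close>, to \<open>v\<close> and to \<open>w\<close>,
  respectively; the last clause states that they are bounded.\<close>

definition fundamental_decomposition ::
  "('a::complex_inner \<Rightarrow> 'a) \<Rightarrow> 'a set \<Rightarrow> 'a set \<Rightarrow> 'a set \<Rightarrow> bool" where
  "fundamental_decomposition G L Lp Lm \<longleftrightarrow>
     (let L0 = isotropic_part G L in
       positive_subspace G Lp \<and> negative_subspace G Lm \<and>
       G_orthogonal G Lp Lm \<and> G_orthogonal G Lp L0 \<and> G_orthogonal G Lm L0 \<and>
       L = {u + v + w | u v w. u \<in> Lp \<and> v \<in> Lm \<and> w \<in> L0} \<and>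
       (\<forall>u\<in>Lp. \<forall>v\<in>Lm. \<forall>w\<in>L0. u + v + w = 0 \<longrightarrow> u = 0 \<and> v = 0 \<and> w = 0) \<and>
       (\<exists>K. \<forall>u\<in>Lp. \<forall>v\<in>Lm. \<forall>w\<in>L0.
          norm u \<le> K * norm (u + v + w) \<and> norm v \<le> K * norm (u + v + w) \<and>
          norm w \<le> K * norm (u + v + w)))"

text \<open>Every closed subspace has a fundamental decomposition and the dimensions of its components do
  not depend on the choice, so the definite descriptions below are meaningful.\<close>

definition kappa_plus :: "('a::complex_inner \<Rightarrow> 'a) \<Rightarrow> 'a set \<Rightarrow> enat" where
  "kappa_plus G L = (THE d. \<exists>Lp Lm. fundamental_decomposition G L Lp Lm \<and> d = cdim Lp)"

definition kappa_minus :: "('a::complex_inner \<Rightarrow> 'a) \<Rightarrow> 'a set \<Rightarrow> enat" where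
  "kappa_minus G L = (THE d. \<exists>Lp Lm. fundamental_decomposition G L Lp Lm \<and> d = cdim Lm)"

definition kappa_zero :: "('a::complex_inner \<Rightarrow> 'a) \<Rightarrow> 'a set \<Rightarrow> enat" where
  "kappa_zero G L = cdim (isotropic_part G L)"

definition kappa_plus_zero :: "('a::complex_inner \<Rightarrow> 'a) \<Rightarrow> 'a set \<Rightarrow> enat" where
  "kappa_plus_zero G L = kappa_plus G L + kappa_zero G L"

definition kappa_minus_zero :: "('a::complex_inner \<Rightarrow> 'a) \<Rightarrow> 'a set \<Rightarrow> enat" where
  "kappa_minus_zero G L = kappa_minus G L + kappa_zero G L"

end

theory Submission
  imports Defs
begin

text \<open>
  Put \<open>T = A - \<mu>\<close> and \<open>L = ker T\<close>. A maximal system of \<open>[\<cdot>,\<cdot>]\<close>-orthonormal negative vectors of \<open>L\<close>,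
  followed by a basis of \<open>L\<^sup>\<circ>\<close>, gives vectors \<open>e\<^sub>i\<close>, \<open>i < N\<close>, in \<open>L\<close> with
  \<open>N = \<kappa>\<^bsub>-,0\<^esub>(L)\<close>; it is finite because \<open>[\<cdot>,\<cdot>]\<close> is positive on a subspace of finite codimension.
  Since \<open>G\<close> is injective there are dual vectors \<open>g\<^sub>j\<close> with \<open>[e\<^sub>i, g\<^sub>j] = \<delta>\<^sub>i\<^sub>j\<close>, and
  \<open>F x = \<Sum>\<^sub>i [x, g\<^sub>i] g\<^sub>i\<close> is the required perturbation: if \<open>(T + F) x\<^sub>n \<rightarrow> 0\<close>, then pairing with
  \<open>e\<^sub>j \<in> ker T\<close> yields \<open>[x\<^sub>n, g\<^sub>j] \<rightarrow> 0\<close>, so up to a null sequence \<open>x\<^sub>n\<close> lies in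
  \<open>E = {x \<in> D. \<forall>i. [x, g\<^sub>i] = 0}\<close> and \<open>T x\<^sub>n \<rightarrow> 0\<close>.

  On \<open>E \<inter> L\<close> the form is positive. On a subspace of finite codimension of \<open>E\<close> the hypothesis says
  \<open>[x, x] + c \<parallel>T x\<parallel>\<^sup>2 \<ge> d \<parallel>x\<parallel>\<^sup>2\<close> for some \<open>c\<close> and \<open>d > 0\<close>. Adding one dimension at a time, this
  inequality (with other constants) extends to \<open>E\<close>, as minimisers of \<open>[x, x] + t \<parallel>T x\<parallel>\<^sup>2\<close> over a
  translate of the smaller subspace converge for \<open>t \<rightarrow> \<infinity>\<close> to an element of \<open>L\<close>, so no weak compactness is needed.
  The statement for the negative type is the one for the positive type with \<open>-G\<close>.
\<close>

section \<open>Independence modulo a subspace\<close>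

context vector_space
begin

lemma independent_Un_finite:
  assumes "independent S" "independent E" "finite E" "span S \<inter> span E = {0}"
  shows "independent (S \<union> E)"
  using assms(3,2,4)
proof (induction E rule: finite_induct)
  case empty
  then show ?case using assms(1) by simp
next
  case (insert e E)
  have ie: "independent E" "e \<notin> span E"
    using insert.prems(1) insert.hyps(2) by (auto simp: independent_insert)
  have "span E \<subseteq> span (insert e E)" by (rule span_mono) auto
  then have "span S \<inter> span E = {0}"
    using insert.prems(2) span_zero[of S] span_zero[of E] by auto
  then have IH: "independent (S \<union> E)" using insert.IH ie by blast
  have "e \<notin> span (S \<union> E)"
  proof
    assume "e \<in> span (S \<union> E)"
    then obtain s v where sv: "s \<in> span S" "v \<in> span E" "e = s + v"
      unfolding span_Un by blast
    have "s = e - v" using sv by simp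
    also have "\<dots> \<in> span (insert e E)"
      using sv(2) by (meson span_base span_diff span_mono subset_insertI insertI1 subsetD)
    finally have "s = 0" using insert.prems(2) sv(1) by blast
    then show False using sv ie by simp
  qed
  then show ?case using IH by (simp add: independent_insertI)
qed

lemma finite_subset_span:
  assumes "finite S" "S \<subseteq> span X"
  obtains Y where "finite Y" "Y \<subseteq> X" "S \<subseteq> span Y"
proof -
  have "\<exists>Y. finite Y \<and> Y \<subseteq> X \<and> S \<subseteq> span Y"
    using assms
  proof (induction S rule: finite_induct)
    case empty
    then show ?case by blast
  next
    case (insert s S)
    then obtain Y where Y: "finite Y" "Y \<subseteq> X" "S \<subseteq> span Y" by blast
    obtain t r where t: "finite t" "t \<subseteq> X" "s = (\<Sum>a\<in>t. scale (r a) a)"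
      using insert.prems unfolding span_explicit by blast
    have "s \<in> span t" unfolding t(3) by (intro span_sum span_scale span_base)
    then have "insert s S \<subseteq> span (Y \<union> t)"
      using Y(3) span_mono[of Y "Y \<union> t"] span_mono[of t "Y \<union> t"] by auto
    then show ?case using Y t by (metis Un_subset_iff finite_Un)
  qed
  then show ?thesis using that by blast
qed

text \<open>Independent vectors whose span meets \<open>Y\<close> only in 0 stay independent in the
  quotient by \<open>Y\<close>, which the cosets of \<open>B\<close> span. The quotient is avoided:
  a finite part \<open>S'\<close> of \<open>S\<close> needs only finitely many vectors of
  \<open>Y\<close>, and a basis \<open>E\<close> of these gives an independent set
  \<open>S' \<union> E\<close> in the span of \<open>E \<union> B\<close>, so the exchange lemma
  applies.\<close>

lemma independent_modulo_subspace_card_le: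
  assumes Y: "subspace Y" and B: "finite B" and S: "independent S"
    and sub: "S \<subseteq> span (Y \<union> B)" and int: "span S \<inter> Y = {0}"
  shows "finite S \<and> card S \<le> card B"
proof -
  have *: "card S' \<le> card B" if S': "finite S'" "S' \<subseteq> S" for S'
  proof -
    obtain X where X: "finite X" "X \<subseteq> Y \<union> B" "S' \<subseteq> span X"
      using finite_subset_span[OF S'(1)] S'(2) sub by blast
    obtain E where E: "E \<subseteq> X \<inter> Y" "independent E" "X \<inter> Y \<subseteq> span E"
      using maximal_independent_subset by blast
    have finE: "finite E" using E(1) X(1) by (meson finite_Int finite_subset)
    have "span E \<subseteq> Y" using E(1) Y by (meson Int_subset_iff span_minimal subset_trans)
    moreover have "span S' \<subseteq> span S" using S'(2) by (rule span_mono)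
    ultimately have "span S' \<inter> span E \<subseteq> {0}" using int by auto
    then have intE: "span S' \<inter> span E = {0}" using span_zero[of S'] span_zero[of E] by auto
    then have ind: "independent (S' \<union> E)"
      by (rule independent_Un_finite[OF independent_mono[OF S S'(2)] E(2) finE])
    have "X \<subseteq> span (E \<union> B)"
    proof
      fix x assume "x \<in> X"
      then consider "x \<in> B" | "x \<in> X \<inter> Y" using X(2) by blast
      then show "x \<in> span (E \<union> B)"
        using E(3) span_mono[of E "E \<union> B"] span_base[of x "E \<union> B"] by cases auto
    qed
    then have "span X \<subseteq> span (E \<union> B)" by (simp add: span_minimal)
    then have "S' \<union> E \<subseteq> span (E \<union> B)"
      using X(3) span_superset[of "E \<union> B"] by blast
    then have "card (S' \<union> E) \<le> card (E \<union> B)"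
      using independent_span_bound[of "E \<union> B" "S' \<union> E"] ind finE B by auto
    also have "\<dots> \<le> card E + card B" by (rule card_Un_le)
    finally have le: "card (S' \<union> E) \<le> card E + card B" .
    have "S' \<inter> E = {}"
    proof -
      have "0 \<notin> S'" using S S'(2) dependent_zero by blast
      moreover have "S' \<inter> E \<subseteq> span S' \<inter> span E" by (auto intro: span_base)
      ultimately show ?thesis using intE by auto
    qed
    then have "card (S' \<union> E) = card S' + card E"
      using card_Un_disjoint S'(1) finE by blast
    then show ?thesis using le by simp
  qed
  have "finite S"
  proof (rule ccontr)
    assume "infinite S"
    then obtain S' where "S' \<subseteq> S" "finite S'" "card S' = Suc (card B)"
      using infinite_arbitrarily_large by blast
    then show False using *[of S'] by simp
  qed
  then show ?thesis using * by blast
qed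

end

lemma cdim_eq_card:
  assumes "complex_vector.independent B" "finite B" "B \<subseteq> V" "V \<subseteq> cspan B"
  shows "cdim V = enat (card B)"
proof -
  have "complex_vector.dim V = card B"
    using assms complex_vector.basis_card_eq_dim by metis
  then show ?thesis using assms unfolding cdim_def by auto
qed

section \<open>Bounded hermitian forms\<close>

lemma cinner_add_right: "cinner x (y + z) = cinner x y + cinner x z"
  by (metis cinner_add_left cinner_commute complex_cnj_add)

lemma cinner_scaleC_right: "cinner x (c *\<^sub>C y) = cnj c * cinner x y"
  by (metis cinner_scaleC_left cinner_commute complex_cnj_mult)

text \<open>The norm axioms give homogeneity for real scalars only; for complex scalars it comes
  from the inner product.\<close>

lemma norm_scaleC: "norm (c *\<^sub>C x) = cmod c * norm (x::'a::complex_inner)"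
proof -
  have "complex_of_real ((norm (c *\<^sub>C x))\<^sup>2) = c * cnj c * complex_of_real ((norm x)\<^sup>2)"
    by (simp only: cinner_self[symmetric] cinner_scaleC_left cinner_scaleC_right mult.assoc mult.left_commute)
  also have "\<dots> = complex_of_real ((cmod c * norm x)\<^sup>2)"
    using complex_norm_square[of c] by (simp add: power_mult_distrib)
  finally have "(norm (c *\<^sub>C x))\<^sup>2 = (cmod c * norm x)\<^sup>2"
    using of_real_eq_iff by blast
  then show ?thesis by (simp add: power2_eq_iff_nonneg)
qed

lemma cinner_zero_left [simp]: "cinner 0 y = 0"
  using cinner_add_left[of 0 0 y] by simp

lemma cinner_minus_left: "cinner (- x) y = - cinner x y"
  using cinner_scaleC_left[of "-1" x y] by simp

lemma cinner_minus_right: "cinner x (- y) = - cinner x y"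
  using cinner_scaleC_right[of x "-1" y] by simp

lemma norm_add_squared:
  "(norm (x + y))\<^sup>2 = (norm x)\<^sup>2 + 2 * Re (cinner x y) + (norm (y::'a::complex_inner))\<^sup>2"
proof -
  have "complex_of_real ((norm (x + y))\<^sup>2) = cinner x x + cinner x y + cnj (cinner x y) + cinner y y"
    by (simp only: cinner_self[symmetric] cinner_add_left cinner_add_right
        cinner_commute[of y x, symmetric] ac_simps)
  then have "complex_of_real ((norm (x + y))\<^sup>2)
      = complex_of_real ((norm x)\<^sup>2 + 2 * Re (cinner x y) + (norm y)\<^sup>2)"
    by (simp add: cinner_self complex_eq_iff)
  then show ?thesis using of_real_eq_iff by blast
qed

lemma cinner_Cauchy_Schwarz: "cmod (cinner x y) \<le> norm x * norm (y::'a::complex_inner)"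
proof (cases "y = 0")
  case True
  then show ?thesis using cinner_commute[of x y] by simp
next
  case False
  \<comment> \<open>This choice makes \<open>x + c *\<^sub>C y\<close> orthogonal to
    \<open>y\<close>.\<close>
  define c where "c = - (cinner x y / complex_of_real ((norm y)\<^sup>2))"
  have ny: "norm y > 0" using False by simp
  have "0 \<le> (norm (x + c *\<^sub>C y))\<^sup>2" by simp
  also have "\<dots> = (norm x)\<^sup>2 + 2 * Re (cnj c * cinner x y) + (cmod c * norm y)\<^sup>2"
    by (simp add: norm_add_squared cinner_scaleC_right norm_scaleC)
  also have "cnj c * cinner x y = - complex_of_real ((cmod (cinner x y))\<^sup>2 / (norm y)\<^sup>2)"
    using complex_norm_square[of "cinner x y"] unfolding c_def by (simp add: mult.commute)
  also have "cmod c = cmod (cinner x y) / (norm y)\<^sup>2"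
    unfolding c_def by (simp add: norm_divide norm_power)
  also have "(\<dots> * norm y)\<^sup>2 = (cmod (cinner x y))\<^sup>2 / (norm y)\<^sup>2"
    using ny by (simp add: power2_eq_square)
  finally have "(cmod (cinner x y))\<^sup>2 / (norm y)\<^sup>2 \<le> (norm x)\<^sup>2" by simp
  then have "(cmod (cinner x y))\<^sup>2 \<le> (norm x * norm y)\<^sup>2"
    using ny by (simp add: divide_le_eq power_mult_distrib)
  then show ?thesis by (meson norm_ge_zero mult_nonneg_nonneg power2_le_imp_le)
qed

lemma bounded_bilinear_cinner: "bounded_bilinear (cinner :: 'a::complex_inner \<Rightarrow> _)"
proof
  fix x y z :: 'a and r :: real
  show "cinner (x + y) z = cinner x z + cinner y z" by (rule cinner_add_left)
  show "cinner x (y + z) = cinner x y + cinner x z" by (rule cinner_add_right)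
  show "cinner (r *\<^sub>R x) y = r *\<^sub>R cinner x y"
    by (simp add: scaleR_scaleC cinner_scaleC_left scaleR_conv_of_real)
  show "cinner x (r *\<^sub>R y) = r *\<^sub>R cinner x y"
    by (simp add: scaleR_scaleC cinner_scaleC_right scaleR_conv_of_real)
  show "\<exists>K. \<forall>a b::'a. norm (cinner a b) \<le> norm a * norm b * K"
    by (rule exI[of _ 1]) (simp add: cinner_Cauchy_Schwarz)
qed

lemma bounded_linear_scaleC_left: "bounded_linear (\<lambda>c. c *\<^sub>C (x::'a::complex_inner))"
  by (rule bounded_linear_intro[where K = "norm x"])
    (simp_all add: scaleC_add_left scaleR_scaleC scaleC_scaleC scaleR_conv_of_real norm_scaleC)

lemma bounded_linear_scaleC_right: "bounded_linear (\<lambda>x::'a::complex_inner. c *\<^sub>C x)"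
  by (rule bounded_linear_intro[where K = "cmod c"])
    (simp_all add: scaleC_add_right scaleR_scaleC scaleC_scaleC mult.commute norm_scaleC)


section \<open>Linear operators on a domain\<close>

lemma linear_operator_zero: "linear_operator D T \<Longrightarrow> T 0 = 0"
  unfolding linear_operator_def
  by (metis complex_vector.scale_zero_left complex_vector.subspace_0)

lemma linear_operator_diff:
  assumes "linear_operator D T" "x \<in> D" "y \<in> D"
  shows "T (x - y) = T x - T y"
proof -
  have "T (x + (- 1) *\<^sub>C y) = T x + (- 1) *\<^sub>C T y"
    using assms unfolding linear_operator_def by (metis complex_vector.subspace_scale)
  then show ?thesis by simp
qed

lemma linear_operator_scaleR:
  assumes "linear_operator D T" "x \<in> D"
  shows "T (r *\<^sub>R x) = r *\<^sub>R T x"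
  using assms unfolding linear_operator_def by (simp add: scaleR_scaleC)

lemma csubspace_scaleR: "csubspace V \<Longrightarrow> x \<in> V \<Longrightarrow> r *\<^sub>R x \<in> V"
  by (simp add: scaleR_scaleC complex_vector.subspace_scale)

section \<open>The hermitian form of a bounded selfadjoint operator\<close>

locale bounded_form =
  fixes G :: "'a::complex_hilbert \<Rightarrow> 'a"
  assumes bounded: "bounded_clinear G" and self: "selfadjoint G"
begin

abbreviation form :: "'a \<Rightarrow> 'a \<Rightarrow> complex" where "form \<equiv> gform G"

abbreviation qform :: "'a \<Rightarrow> real" where "qform x \<equiv> Re (form x x)"

lemma bounded_bilinear_form: "bounded_bilinear form"
proof -
  have "gform G = (\<lambda>x. cinner (G x))" by (intro ext) (simp add: gform_def)
  then show ?thesis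
    using bounded bounded_bilinear.comp1[OF bounded_bilinear_cinner, of G]
    unfolding bounded_clinear_def by simp
qed

sublocale form: bounded_bilinear form
  by (rule bounded_bilinear_form)

lemma form_commute: "form x y = cnj (form y x)"
  unfolding gform_def using self selfadjoint_def cinner_commute by metis

lemma form_scaleC_left: "form (c *\<^sub>C x) y = c * form x y"
  using bounded unfolding gform_def bounded_clinear_def by (simp add: cinner_scaleC_left)

lemma form_scaleC_right: "form x (c *\<^sub>C y) = cnj c * form x y"
  unfolding gform_def by (simp add: cinner_scaleC_right)

lemma form_self: "form x x = complex_of_real (qform x)"
proof -
  have "Im (form x x) = 0" using form_commute[of x x] by (simp add: complex_eq_iff)
  then show ?thesis by (simp add: complex_eq_iff)
qed

lemma form_bound: obtains K where "K > 0" "\<And>x y. cmod (form x y) \<le> K * norm x * norm y"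
proof -
  obtain K where "K > 0" "\<And>x y. norm (form x y) \<le> norm x * norm y * K"
    using form.pos_bounded by blast
  then show ?thesis using that[of K] by (simp add: ac_simps)
qed

lemma qform_add: "qform (x + y) = qform x + 2 * Re (form x y) + qform y"
  using form_commute[of y x] by (simp add: form.add_left form.add_right)

lemma qform_scaleR: "qform (r *\<^sub>R x) = r\<^sup>2 * qform x"
  by (simp add: form.scaleR_left form.scaleR_right power2_eq_square)

text \<open>The equality case behind the Cauchy-Schwarz inequality for a semidefinite form: moving
  from \<open>y\<close> along a suitable multiple of the null vector \<open>u\<close> changes
  \<open>qform\<close> by \<open>- 2 * t * b\<close>, which would become arbitrarily negative if
  \<open>form u y\<close> were nonzero.\<close>

lemma nonneg_null_isotropic:
  assumes V: "csubspace V" and nn: "\<And>x. x \<in> V \<Longrightarrow> qform x \<ge> 0"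
    and u: "u \<in> V" "qform u = 0" and y: "y \<in> V"
  shows "form u y = 0"
proof (rule ccontr)
  assume "form u y \<noteq> 0"
  define b where "b = (cmod (form u y))\<^sup>2"
  have b: "b > 0" using \<open>form u y \<noteq> 0\<close> by (simp add: b_def)
  have "0 \<le> qform y - 2 * t * b" for t
  proof -
    define c where "c = - (complex_of_real t * cnj (form u y))"
    have "c *\<^sub>C u + y \<in> V"
      using V u(1) y by (simp add: complex_vector.subspace_add complex_vector.subspace_scale)
    then have "0 \<le> qform (c *\<^sub>C u + y)" by (rule nn)
    also have "\<dots> = 2 * Re (c * form u y) + qform y"
      using u(2) form_self[of u]
      by (simp add: qform_add form_scaleC_left form_scaleC_right)
    also have "c * form u y = - complex_of_real (t * b)"
      using complex_norm_square[of "form u y"]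
      by (simp add: c_def b_def mult.assoc mult.commute[of "cnj _"])
    finally show ?thesis by simp
  qed
  \<comment> \<open>For this \<open>t\<close> the lower bound \<open>0\<close> would apply to the
    value \<open>- 1\<close>.\<close>
  from this[of "(qform y + 1) / (2 * b)"] b show False by (simp add: field_simps)
qed

section \<open>Coercivity relative to an operator\<close>

text \<open>A quantitative substitute for positive type: along unit vectors of \<open>V\<close> with
  \<open>T x\<close> tending to 0 the lower limit of \<open>qform\<close> is at least
  \<open>d\<close>. Unlike the condition on sequences it can be extended dimension by
  dimension.\<close>

definition coercive_on :: "('a \<Rightarrow> 'a) \<Rightarrow> 'a set \<Rightarrow> bool" where
  "coercive_on T V \<longleftrightarrow> (\<exists>c d. d > 0 \<and> (\<forall>x\<in>V. d * (norm x)\<^sup>2 \<le> qform x + c * (norm (T x))\<^sup>2))"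


lemma qform_scaleC: "qform (c *\<^sub>C x) = (cmod c)\<^sup>2 * qform x"
proof -
  have "form (c *\<^sub>C x) (c *\<^sub>C x) = complex_of_real ((cmod c)\<^sup>2) * form x x"
    using complex_norm_square[of c] by (simp add: form_scaleC_left form_scaleC_right mult.assoc)
  then show ?thesis by simp
qed

lemma qform_le: obtains K where "K > 0" "\<And>x. \<bar>qform x\<bar> \<le> K * (norm x)\<^sup>2"
proof -
  obtain K where K: "K > 0" "\<And>x y. cmod (form x y) \<le> K * norm x * norm y"
    using form_bound by blast
  have "\<bar>qform x\<bar> \<le> K * (norm x)\<^sup>2" for x
    using K(2)[of x x] abs_Re_le_cmod[of "form x x"] by (simp add: power2_eq_square mult.assoc)
  then show ?thesis using that K(1) by blast
qed

text \<open>A failure on the larger space must involve \<open>z\<close>, so after scaling it occurs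
  on the affine set \<open>V + z\<close>, where a quadratic functional is nearly minimised.
  Completeness and \<open>closed\<close> send the near-minimisers to a kernel vector with
  nonpositive form, which \<open>pos\<close> forces to be 0. Then \<open>z\<close> is a graph limit
  of elements of \<open>V\<close>, so coercivity on \<open>V\<close> already covers it.\<close>

lemma coercive_on_extend:
  assumes lin: "linear_operator D T" and E: "csubspace E" "E \<subseteq> D"
    and closed: "\<And>s x. \<lbrakk>\<And>n. s n \<in> E; s \<longlonglongrightarrow> x; (\<lambda>n. T (s n)) \<longlonglongrightarrow> 0\<rbrakk> \<Longrightarrow> x \<in> E \<and> T x = 0"
    and pos: "\<And>x. \<lbrakk>x \<in> E; T x = 0; x \<noteq> 0\<rbrakk> \<Longrightarrow> qform x > 0"
    and V: "csubspace V" "V \<subseteq> E" "coercive_on T V" and z: "z \<in> E"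
  shows "coercive_on T {v + a *\<^sub>C z | v a. v \<in> V}" (is "coercive_on T ?W")
proof (rule ccontr)
  assume neg: "\<not> coercive_on T ?W"
  have VD: "x \<in> D" if "x \<in> V" for x using that V(2) E(2) by blast
  have zD: "z \<in> D" using z E(2) by blast
  have D: "csubspace D" using lin by (simp add: linear_operator_def)
  note subs = complex_vector.subspace_add complex_vector.subspace_diff
    complex_vector.subspace_scale csubspace_scaleR
  have Tadd: "T (x + y) = T x + T y" if "x \<in> D" "y \<in> D" for x y
    using lin that by (simp add: linear_operator_def)
  have Tscale: "T (a *\<^sub>C x) = a *\<^sub>C T x" if "x \<in> D" for x a
    using lin that by (simp add: linear_operator_def)
  obtain c d where cd: "d > 0" "\<And>x. x \<in> V \<Longrightarrow> d * (norm x)\<^sup>2 \<le> qform x + c * (norm (T x))\<^sup>2"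
    using V(3) unfolding coercive_on_def by blast
  obtain K where K: "K > 0" "\<And>x y. cmod (form x y) \<le> K * norm x * norm y"
    using form_bound by blast
  \<comment> \<open>The sequence \<open>e\<close> has two uses: as the constants for which
    coercivity fails, and as the tolerance of the near-minimisers.\<close>
  define e where "e t = inverse (real (Suc t))" for t
  have e0: "e t > 0" for t by (simp add: e_def)
  have elim: "e \<longlonglongrightarrow> 0" unfolding e_def by (rule LIMSEQ_inverse_real_of_nat)
  have eanti: "e s \<le> e t" if "t \<le> s" for s t using that by (simp add: e_def le_imp_inverse_le)
  define p where "p t x = qform x + real t * (norm (T x))\<^sup>2 - e t * (norm x)\<^sup>2" for t x
  \<comment> \<open>\<open>b t\<close> is the real polar form of the quadratic functional
    \<open>p t\<close>.\<close>
  define b where "b t x y = Re (form x y) + real t * Re (cinner (T x) (T y)) - e t * Re (cinner x y)"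
    for t x y
  \<comment> \<open>\<open>p t\<close> increases with \<open>t\<close> and is uniformly positive on \<open>V\<close> for large \<open>t\<close>. If coercivity fails on
    \<open>?W\<close>, then \<open>p t\<close> is negative somewhere on \<open>V + z\<close>, and near-minimisers there form a Cauchy
    sequence by the parallelogram law.\<close>
  have p_add: "p t (x + y) = p t x + 2 * b t x y + p t y" if "x \<in> D" "y \<in> D" for t x y
    unfolding p_def b_def Tadd[OF that] norm_add_squared qform_add by (simp add: algebra_simps)
  have p_scale: "p t (a *\<^sub>C x) = (cmod a)\<^sup>2 * p t x" if "x \<in> D" for t x a
    unfolding p_def Tscale[OF that] norm_scaleC qform_scaleC
    by (simp add: algebra_simps power_mult_distrib)
  have p_mono: "p t x + (real s - real t) * (norm (T x))\<^sup>2 \<le> p s x" if "t \<le> s" for s t x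
    using mult_right_mono[OF eanti[OF that], of "(norm x)\<^sup>2"] unfolding p_def
    by (simp add: algebra_simps)
  have p_mono': "p t x \<le> p s x" if "t \<le> s" for s t x
    using p_mono[OF that, of x] that
    by (smt (verit) mult_nonneg_nonneg of_nat_mono zero_le_power2)
  \<comment> \<open>From level \<open>t0\<close> on, \<open>p t\<close> dominates on
    \<open>V\<close> half of the coercivity constant plus one spare copy of the squared norm of
    \<open>T x\<close>. The spare copy absorbs the mixed terms in \<open>T\<close> below.\<close>
  obtain t1 where t1: "c + 1 \<le> real t1" using real_arch_simple by blast
  obtain t2 where t2: "e t2 < d / 2"
    using reals_Archimedean[of "d / 2"] cd(1) by (auto simp: e_def)
  define t0 where "t0 = max t1 t2"
  have t0: "c + 1 \<le> real t0" "e t0 \<le> d / 2"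
    using t1 t2 eanti[of t2 t0] by (auto simp: t0_def)
  have pV0: "d / 2 * (norm x)\<^sup>2 + (norm (T x))\<^sup>2 \<le> p t0 x" if "x \<in> V" for x
  proof -
    have "(c + 1) * (norm (T x))\<^sup>2 \<le> real t0 * (norm (T x))\<^sup>2"
      "e t0 * (norm x)\<^sup>2 \<le> d / 2 * (norm x)\<^sup>2"
      using t0 by (intro mult_right_mono; simp)+
    then show ?thesis using cd(2)[OF that] unfolding p_def by (simp add: algebra_simps)
  qed
  have pV: "d / 2 * (norm x)\<^sup>2 + (norm (T x))\<^sup>2 \<le> p t x" if "x \<in> V" "t \<ge> t0" for x t
    using pV0[OF that(1)] p_mono'[OF that(2), of x] by linarith
  \<comment> \<open>The failing vector has a nonzero \<open>z\<close> coefficient \<open>a\<close>,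
    since \<open>p t\<close> is nonnegative on \<open>V\<close>; dividing by \<open>a\<close> moves
    it to \<open>V + z\<close>.\<close>
  have ex_neg: "\<exists>k\<in>V. p t (k + z) < 0" if t: "t \<ge> t0" for t
  proof -
    from neg have "\<exists>x\<in>?W. qform x + real t * (norm (T x))\<^sup>2 < e t * (norm x)\<^sup>2"
      unfolding coercive_on_def using e0[of t] by (meson not_le)
    then obtain v a where va: "v \<in> V" "p t (v + a *\<^sub>C z) < 0" unfolding p_def by auto
    have "a \<noteq> 0"
    proof
      assume "a = 0"
      then have "p t v < 0" using va(2) by simp
      moreover have "0 \<le> d / 2 * (norm v)\<^sup>2 + (norm (T v))\<^sup>2" using cd(1) by simp
      ultimately show False using pV[OF va(1) t] by linarith
    qed
    have vaD: "v + a *\<^sub>C z \<in> D" using D VD[OF va(1)] zD by (simp add: subs)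
    have eq: "inverse a *\<^sub>C v + z = inverse a *\<^sub>C (v + a *\<^sub>C z)"
      using \<open>a \<noteq> 0\<close> by (simp add: scaleC_add_right scaleC_scaleC)
    have "p t (inverse a *\<^sub>C v + z) = (cmod (inverse a))\<^sup>2 * p t (v + a *\<^sub>C z)"
      unfolding eq by (rule p_scale[OF vaD])
    also have "\<dots> < 0"
      using va(2) \<open>a \<noteq> 0\<close> by (simp add: mult_pos_neg)
    finally show ?thesis using V(1) va(1) by (meson complex_vector.subspace_scale)
  qed
  \<comment> \<open>Lower bound on \<open>V + z\<close>: the mixed terms are linear in
    \<open>norm k\<close> and \<open>norm (T k)\<close>, with coefficients \<open>P\<close> and
    \<open>Q\<close>, and completing two squares absorbs them into the quadratic terms of
    \<open>pV0\<close>.\<close>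
  obtain C where C: "\<And>k. k \<in> V \<Longrightarrow> - C \<le> p t0 (k + z)"
  proof -
    define P where "P = K * norm z + e t0 * norm z"
    define Q where "Q = real t0 * norm (T z)"
    have "- (2 * P\<^sup>2 / d + Q\<^sup>2 - p t0 z) \<le> p t0 (k + z)" if k: "k \<in> V" for k
    proof -
      have "\<bar>Re (form k z)\<bar> \<le> K * norm k * norm z"
        using K(2) abs_Re_le_cmod order_trans by blast
      moreover have "\<bar>real t0 * Re (cinner (T k) (T z))\<bar> \<le> real t0 * (norm (T k) * norm (T z))"
        unfolding abs_mult
        by (metis abs_Re_le_cmod abs_of_nat cinner_Cauchy_Schwarz mult_left_mono of_nat_0_le_iff order_trans)
      moreover have "\<bar>e t0 * Re (cinner k z)\<bar> \<le> e t0 * (norm k * norm z)"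
        unfolding abs_mult using e0[of t0]
        by (metis abs_Re_le_cmod abs_of_pos cinner_Cauchy_Schwarz mult_left_mono less_imp_le order_trans)
      ultimately have bb: "\<bar>b t0 k z\<bar> \<le> P * norm k + Q * norm (T k)"
        unfolding b_def P_def Q_def by (simp add: algebra_simps)
      have "0 \<le> d / 2 * (norm k - 2 * P / d)\<^sup>2" using cd(1) by simp
      also have "\<dots> = d / 2 * (norm k)\<^sup>2 - 2 * P * norm k + 2 * P\<^sup>2 / d"
        using cd(1) by (simp add: power2_eq_square field_simps)
      finally have 1: "2 * P * norm k \<le> d / 2 * (norm k)\<^sup>2 + 2 * P\<^sup>2 / d" by simp
      have "0 \<le> (norm (T k) - Q)\<^sup>2" by simp
      then have 2: "2 * Q * norm (T k) \<le> (norm (T k))\<^sup>2 + Q\<^sup>2"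
        by (simp add: power2_eq_square algebra_simps)
      have "p t0 (k + z) = p t0 k + 2 * b t0 k z + p t0 z"
        using p_add[OF VD[OF k] zD] .
      then show ?thesis using pV0[OF k] bb 1 2 by linarith
    qed
    then show ?thesis using that by blast
  qed
  have C': "- C \<le> p t (k + z)" if "k \<in> V" "t \<ge> t0" for k t
    using C[OF that(1)] p_mono'[OF that(2), of "k + z"] by linarith
  define m where "m t = (INF k\<in>V. p t (k + z))" for t
  have bdd: "bdd_below ((\<lambda>k. p t (k + z)) ` V)" if "t \<ge> t0" for t
    using C' that by (intro bdd_belowI2) blast
  have m_le: "m t \<le> p t (k + z)" if "k \<in> V" "t \<ge> t0" for t k
    unfolding m_def using bdd[OF that(2)] that(1) by (rule cINF_lower)
  have V0: "0 \<in> V" using V(1) by (rule complex_vector.subspace_0)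
  \<comment> \<open>The infimum is strictly negative, so a point close to it can be chosen with a
    negative value as well.\<close>
  have ex_k: "\<exists>k\<in>V. p t (k + z) < 0 \<and> p t (k + z) < m t + e t" if t: "t \<ge> t0" for t
  proof -
    obtain k where k: "k \<in> V" "p t (k + z) < 0" using ex_neg[OF t] by blast
    have "m t < min 0 (m t + e t)" using m_le[OF k(1) t] k(2) e0[of t] by simp
    then have "\<exists>k\<in>V. p t (k + z) < min 0 (m t + e t)"
      unfolding m_def using V0 bdd[OF t] by (subst (asm) cINF_less_iff) auto
    then show ?thesis by auto
  qed
  then obtain k where k: "\<And>t. t \<ge> t0 \<Longrightarrow> k t \<in> V \<and> p t (k t + z) < 0 \<and> p t (k t + z) < m t + e t"
    by metis
  have m_mono: "m t \<le> m s" if "t0 \<le> t" "t \<le> s" for s t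
    unfolding m_def
  proof (rule cINF_mono)
    show "V \<noteq> {}" using V0 by blast
    show "bdd_below ((\<lambda>k. p t (k + z)) ` V)" using bdd that by simp
    show "\<exists>n\<in>V. p t (n + z) \<le> p s (h + z)" if "h \<in> V" for h
      using that p_mono'[OF \<open>t \<le> s\<close>] by blast
  qed
  define x where "x n = k (t0 + n) + z" for n
  have kV: "k (t0 + n) \<in> V" for n using k by simp
  have xE: "x n \<in> E" for n
    unfolding x_def using kV V(2) z E(1) by (simp add: subs subset_iff)
  have xD: "x n \<in> D" for n using xE E(2) by blast
  have m_neg: "m (t0 + n) \<le> 0" for n
    using m_le[OF kV[of n], of "t0 + n"] k[of "t0 + n"] by auto
  \<comment> \<open>The infima increase and stay below 0. The gap to their limit \<open>L\<close>
    will control the distances between the near-minimisers.\<close>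
  have "incseq (\<lambda>n. m (t0 + n))" by (intro incseq_SucI m_mono) auto
  then obtain L where L: "(\<lambda>n. m (t0 + n)) \<longlonglongrightarrow> L" "\<And>n. m (t0 + n) \<le> L"
    using incseq_convergent[of "\<lambda>n. m (t0 + n)" 0] m_neg by blast
  define r where "r n = 4 / d * (L - m (t0 + n) + 2 * e (t0 + n))" for n
  \<comment> \<open>Parallelogram law at the lower level \<open>t0 + i\<close>: the midpoint of
    \<open>x i\<close> and \<open>x j\<close> lies in \<open>V + z\<close>, so the sum contributes
    at least \<open>4 * m\<close>, while the difference lies in \<open>V\<close>, where
    \<open>p\<close> controls the norm. The value at \<open>x j\<close> is bounded through the
    higher level by monotonicity.\<close>
  have dist_le: "(norm (x j - x i))\<^sup>2 \<le> r i" if ij: "i \<le> j" for i j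
  proof -
    let ?t = "t0 + i" and ?s = "t0 + j"
    have "p ?t (x j + x i) + p ?t (x j - x i) = 2 * p ?t (x j) + 2 * p ?t (x i)"
    proof -
      have minus: "(- 1) *\<^sub>C x i \<in> D" using xD D by (rule complex_vector.subspace_scale[rotated])
      have "p ?t (x j + (- 1) *\<^sub>C x i) = p ?t (x j) + 2 * b ?t (x j) ((- 1) *\<^sub>C x i) + p ?t ((- 1) *\<^sub>C x i)"
        by (rule p_add[OF xD minus])
      moreover have "b ?t (x j) ((- 1) *\<^sub>C x i) = - b ?t (x j) (x i)"
        unfolding b_def Tscale[OF xD] form_scaleC_right cinner_scaleC_right by (simp add: algebra_simps)
      ultimately show ?thesis using p_add[OF xD xD, of ?t j i] p_scale[OF xD, of ?t "-1" i] by simp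
    qed
    moreover have "p ?t (x j + x i) \<ge> 4 * m ?t"
    proof -
      let ?h = "(1/2) *\<^sub>C (k ?s + k ?t)"
      have hV: "?h \<in> V" using V(1) kV by (simp add: subs)
      have "x j + x i = 2 *\<^sub>C (?h + z)"
        unfolding x_def scaleC_add_right scaleC_scaleC using scaleC_add_left[of 1 1 z] by simp
      moreover have "?h + z \<in> D" using VD[OF hV] zD D by (simp add: subs)
      ultimately have "p ?t (x j + x i) = 4 * p ?t (?h + z)" using p_scale[of "?h + z" ?t 2] by simp
      then show ?thesis using m_le[OF hV, of ?t] by simp
    qed
    moreover have "d / 2 * (norm (x j - x i))\<^sup>2 \<le> p ?t (x j - x i)"
    proof -
      have "x j - x i \<in> V" unfolding x_def using V(1) kV by (simp add: subs)
      then have "d / 2 * (norm (x j - x i))\<^sup>2 + (norm (T (x j - x i)))\<^sup>2 \<le> p ?t (x j - x i)"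
        using pV by simp
      then show ?thesis by (smt (verit) zero_le_power2)
    qed
    moreover have "p ?t (x j) \<le> m ?s + e ?s"
      using p_mono'[of ?t ?s "x j"] k[of ?s] ij unfolding x_def by simp
    moreover have "p ?t (x i) \<le> m ?t + e ?t" using k[of ?t] unfolding x_def by simp
    moreover have "e ?s \<le> e ?t" using eanti ij by simp
    moreover have "m ?s \<le> L" by (rule L(2))
    moreover have "X \<le> 2 * (L - b + 2 * e1)"
      if "P1 + P2 = 2 * P3 + 2 * P4" "P1 \<ge> 4 * b" "X \<le> P2" "P3 \<le> a + e2" "P4 \<le> b + e1"
        "e2 \<le> e1" "a \<le> L" for X P1 P2 P3 P4 a b e1 e2 :: real
      using that by argo
    ultimately have "d / 2 * (norm (x j - x i))\<^sup>2 \<le> 2 * (L - m ?t + 2 * e ?t)" by blast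
    then show ?thesis unfolding r_def using cd(1) by (simp add: field_simps)
  qed
  have e_lim: "(\<lambda>n. e (t0 + n)) \<longlonglongrightarrow> 0" using LIMSEQ_ignore_initial_segment[OF elim, of t0] by (simp add: add.commute)
  have "r \<longlonglongrightarrow> 4 / d * (L - L + 2 * 0)"
    unfolding r_def by (intro tendsto_intros L(1) e_lim)
  then have r0: "r \<longlonglongrightarrow> 0" by simp
  have "Cauchy x"
  proof (rule CauchyI')
    fix \<epsilon> :: real assume \<epsilon>: "\<epsilon> > 0"
    then obtain N where N: "\<And>n. n \<ge> N \<Longrightarrow> norm (r n) < \<epsilon>\<^sup>2"
      using LIMSEQ_D[OF r0, of "\<epsilon>\<^sup>2"] by auto
    have "dist (x i) (x j) < \<epsilon>" if "i \<ge> N" "j > i" for i j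
    proof -
      have "(norm (x j - x i))\<^sup>2 < \<epsilon>\<^sup>2" using dist_le[of i j] N[of i] that by simp
      then show ?thesis using \<epsilon> by (simp add: dist_norm norm_minus_commute power2_less_imp_less)
    qed
    then show "\<exists>M. \<forall>i\<ge>M. \<forall>j>i. dist (x i) (x j) < \<epsilon>" by blast
  qed
  then obtain l where l: "x \<longlonglongrightarrow> l" using Cauchy_convergent convergent_def by blast
  \<comment> \<open>Raising the level from \<open>t0\<close> to \<open>t0 + n\<close> adds at least
    \<open>n\<close> times the squared norm of \<open>T (x n)\<close>, yet the value starts above
    \<open>- C\<close> and ends below 0.\<close>
  have Tx: "(\<lambda>n. T (x n)) \<longlonglongrightarrow> 0"
  proof (rule Lim_null_comparison)
    have "norm (T (x n)) \<le> sqrt (C / real n)" if n: "n > 0" for n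
    proof -
      have "- C + real n * (norm (T (x n)))\<^sup>2 \<le> p (t0 + n) (x n)"
        using p_mono[of t0 "t0 + n" "x n"] C[OF kV[of n]] unfolding x_def by simp
      then have "real n * (norm (T (x n)))\<^sup>2 \<le> C" using k[of "t0 + n"] unfolding x_def by simp
      then have "(norm (T (x n)))\<^sup>2 \<le> C / real n" using n by (simp add: field_simps)
      then show ?thesis by (rule real_le_rsqrt)
    qed
    then show "\<forall>\<^sub>F n in sequentially. norm (T (x n)) \<le> sqrt (C / real n)"
      by (intro eventually_mono[OF eventually_gt_at_top[of "0::nat"]])
    have "(\<lambda>n. sqrt (C / real n)) \<longlonglongrightarrow> sqrt 0"
      by (intro tendsto_intros lim_const_over_n)
    then show "(\<lambda>n. sqrt (C / real n)) \<longlonglongrightarrow> 0" by simp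
  qed
  have lE: "l \<in> E" "T l = 0" using closed[OF xE l Tx] by auto
  \<comment> \<open>Negativity of \<open>p\<close> bounds \<open>qform (x n)\<close> by a null
    sequence, so the kernel vector \<open>l\<close> cannot be positive.\<close>
  have "qform l \<le> 0 * (norm l)\<^sup>2"
  proof (rule LIMSEQ_le)
    show "(\<lambda>n. qform (x n)) \<longlonglongrightarrow> qform l" by (intro tendsto_intros form.tendsto l)
    show "(\<lambda>n. e (t0 + n) * (norm (x n))\<^sup>2) \<longlonglongrightarrow> 0 * (norm l)\<^sup>2"
      by (intro tendsto_intros e_lim l)
    have "qform (x n) \<le> e (t0 + n) * (norm (x n))\<^sup>2" for n
    proof -
      have "p (t0 + n) (x n) < 0" using k[of "t0 + n"] by (simp add: x_def)
      moreover have "0 \<le> real (t0 + n) * (norm (T (x n)))\<^sup>2" by simp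
      ultimately show ?thesis unfolding p_def by linarith
    qed
    then show "\<exists>N. \<forall>n\<ge>N. qform (x n) \<le> e (t0 + n) * (norm (x n))\<^sup>2" by blast
  qed
  then have "l = 0" using pos[OF lE] by force
  \<comment> \<open>Hence \<open>- z\<close> lies in the graph closure of \<open>V\<close>, and the inequality on \<open>V\<close> carries over.\<close>
  have "d * (norm w)\<^sup>2 \<le> qform w + c * (norm (T w))\<^sup>2" if wW: "w \<in> ?W" for w
  proof -
    obtain v a where w: "w = v + a *\<^sub>C z" "v \<in> V" using wW by blast
    \<comment> \<open>Subtracting \<open>a *\<^sub>C x n\<close> cancels the \<open>z\<close>
      component of \<open>w\<close> and leaves an element of \<open>V\<close>.\<close>
    define y where "y n = w - a *\<^sub>C x n" for n
    have wD: "w \<in> D" unfolding w(1) using VD[OF w(2)] zD D by (simp add: subs)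
    have "y n = v - a *\<^sub>C k (t0 + n)" for n
      unfolding y_def w(1) x_def by (simp add: scaleC_add_right)
    then have yV: "y n \<in> V" for n using w(2) kV V(1) by (simp add: subs)
    have Ty: "T (y n) = T w - a *\<^sub>C T (x n)" for n
      unfolding y_def using linear_operator_diff[OF lin wD] Tscale[OF xD] xD D
      by (simp add: subs)
    have ylim: "y \<longlonglongrightarrow> w"
      using tendsto_diff[OF tendsto_const bounded_linear.tendsto[OF bounded_linear_scaleC_right l], of w a]
      by (simp add: \<open>l = 0\<close> y_def[abs_def])
    have Tylim: "(\<lambda>n. T (y n)) \<longlonglongrightarrow> T w"
      using tendsto_diff[OF tendsto_const bounded_linear.tendsto[OF bounded_linear_scaleC_right Tx], of "T w" a]
      by (simp add: Ty)
    show ?thesis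
    proof (rule LIMSEQ_le)
      show "(\<lambda>n. d * (norm (y n))\<^sup>2) \<longlonglongrightarrow> d * (norm w)\<^sup>2" by (intro tendsto_intros ylim)
      show "(\<lambda>n. qform (y n) + c * (norm (T (y n)))\<^sup>2) \<longlonglongrightarrow> qform w + c * (norm (T w))\<^sup>2"
        by (intro tendsto_intros form.tendsto ylim Tylim)
      show "\<exists>N. \<forall>n\<ge>N. d * (norm (y n))\<^sup>2 \<le> qform (y n) + c * (norm (T (y n)))\<^sup>2"
        using cd(2)[OF yV] by blast
    qed
  qed
  then have "coercive_on T ?W" unfolding coercive_on_def using cd(1) by blast
  then show False using neg by contradiction
qed

text \<open>Each new spanning vector \<open>b\<close> enlarges the part of \<open>E\<close> reached
  so far by at most one dimension. As \<open>b\<close> itself may lie outside \<open>E\<close>, a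
  vector \<open>z\<close> of \<open>E\<close> with nonzero \<open>b\<close> component takes its
  place.\<close>

lemma coercive_on_finite_extension:
  assumes lin: "linear_operator D T" and E: "csubspace E" "E \<subseteq> D"
    and closed: "\<And>s x. \<lbrakk>\<And>n. s n \<in> E; s \<longlonglongrightarrow> x; (\<lambda>n. T (s n)) \<longlonglongrightarrow> 0\<rbrakk> \<Longrightarrow> x \<in> E \<and> T x = 0"
    and pos: "\<And>x. \<lbrakk>x \<in> E; T x = 0; x \<noteq> 0\<rbrakk> \<Longrightarrow> qform x > 0"
    and M: "csubspace M" "finite_codim M" and co: "coercive_on T (E \<inter> M)"
  shows "coercive_on T E"
proof -
  obtain B where B: "finite B" "cspan (M \<union> B) = UNIV" using M(2) unfolding finite_codim_def by blast
  from B(1) have "coercive_on T (E \<inter> cspan (M \<union> B))"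
  proof (induction B rule: finite_induct)
    case empty
    have "cspan M = M" using M(1) by simp
    then show ?case using co by (simp only: Un_empty_right)
  next
    case (insert b B)
    let ?M = "cspan (M \<union> B)" and ?M' = "cspan (M \<union> insert b B)"
    have M': "x \<in> ?M' \<longleftrightarrow> (\<exists>a. x - a *\<^sub>C b \<in> ?M)" for x
      using complex_vector.span_breakdown_eq[of x b "M \<union> B"] by simp
    show ?case
    proof (cases "E \<inter> ?M' \<subseteq> ?M")
      case True
      then have "E \<inter> ?M' \<subseteq> E \<inter> ?M" by blast
      then show ?thesis using insert.IH unfolding coercive_on_def by blast
    next
      case False
      then obtain z where z: "z \<in> E" "z \<in> ?M'" "z \<notin> ?M" by blast
      obtain \<beta> where \<beta>: "z - \<beta> *\<^sub>C b \<in> ?M" using z(2) M' by blast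
      have "\<beta> \<noteq> 0" using \<beta> z(3) by auto
      have "E \<inter> ?M' \<subseteq> {v + a *\<^sub>C z | v a. v \<in> E \<inter> ?M}"
      proof
        fix x assume x: "x \<in> E \<inter> ?M'"
        then obtain a where a: "x - a *\<^sub>C b \<in> ?M" using M' by blast
        \<comment> \<open>The coefficient \<open>a / \<beta>\<close> eliminates the \<open>b\<close>
          component of \<open>x\<close>.\<close>
        define v where "v = x - (a / \<beta>) *\<^sub>C z"
        have "v = (x - a *\<^sub>C b) - (a / \<beta>) *\<^sub>C (z - \<beta> *\<^sub>C b)"
          using \<open>\<beta> \<noteq> 0\<close> by (simp add: v_def complex_vector.scale_right_diff_distrib)
        then have "v \<in> ?M"
          using a \<beta> by (simp add: complex_vector.span_diff complex_vector.span_scale)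
        moreover have "v \<in> E"
          unfolding v_def using x z(1) E(1)
          by (simp add: complex_vector.subspace_diff complex_vector.subspace_scale)
        moreover have "x = v + (a / \<beta>) *\<^sub>C z" by (simp add: v_def)
        ultimately show "x \<in> {v + a *\<^sub>C z | v a. v \<in> E \<inter> ?M}" by blast
      qed
      moreover have "coercive_on T {v + a *\<^sub>C z | v a. v \<in> E \<inter> ?M}"
        by (rule coercive_on_extend[OF lin E closed pos])
          (auto simp: E(1) complex_vector.subspace_inter insert.IH z(1))
      ultimately show ?thesis unfolding coercive_on_def by blast
    qed
  qed
  then show ?thesis by (simp add: B(2))
qed


section \<open>Biorthogonal systems and fundamental decompositions\<close>

text \<open>The \<open>g j\<close> represent the coordinate functionals of the \<open>e i\<close>
  through the form. This encodes independence and makes the coordinates continuous on the whole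
  space.\<close>

definition biorthogonal :: "nat \<Rightarrow> (nat \<Rightarrow> 'a) \<Rightarrow> (nat \<Rightarrow> 'a) \<Rightarrow> bool" where
  "biorthogonal N e g \<longleftrightarrow> (\<forall>i<N. \<forall>j<N. form (e i) (g j) = (if i = j then 1 else 0))"

lemma biorthogonal_commute: "biorthogonal N e g \<Longrightarrow> biorthogonal N g e"
  unfolding biorthogonal_def by (subst form_commute) auto

lemma biorthogonal_sum:
  assumes "biorthogonal N e g" "I \<subseteq> {..<N}" "j < N"
  shows "form (\<Sum>i\<in>I. c i *\<^sub>C e i) (g j) = (if j \<in> I then c j else 0)"
proof -
  have fin: "finite I" using assms(2) by (rule finite_subset) simp
  have "form (\<Sum>i\<in>I. c i *\<^sub>C e i) (g j) = (\<Sum>i\<in>I. if i = j then c i else 0)"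
    unfolding form.sum_left form_scaleC_left
    using assms by (intro sum.cong) (auto simp: biorthogonal_def)
  then show ?thesis using fin by simp
qed

lemma biorthogonal_inj: "biorthogonal N e g \<Longrightarrow> inj_on e {..<N}"
  unfolding biorthogonal_def inj_on_def by (metis lessThan_iff zero_neq_one)

lemma biorthogonal_independent:
  assumes "biorthogonal N e g" "I \<subseteq> {..<N}"
  shows "complex_vector.independent (e ` I)"
proof (rule complex_vector.independent_if_scalars_zero)
  have inj: "inj_on e I" using biorthogonal_inj[OF assms(1)] assms(2) by (rule inj_on_subset)
  show "finite (e ` I)" using assms(2) finite_subset by blast
  fix c x assume "(\<Sum>x\<in>e ` I. c x *\<^sub>C x) = 0" and x: "x \<in> e ` I"
  then have 0: "(\<Sum>i\<in>I. c (e i) *\<^sub>C e i) = 0" using inj by (simp add: sum.reindex)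
  obtain j where j: "j \<in> I" "x = e j" using x by blast
  have "form (\<Sum>i\<in>I. c (e i) *\<^sub>C e i) (g j) = c (e j)"
    using biorthogonal_sum[OF assms, of j "\<lambda>i. c (e i)"] j assms(2) by auto
  then show "c x = 0" using 0 j by (simp add: form.zero_left)
qed

lemma biorthogonal_cdim:
  assumes "biorthogonal N e g" "I \<subseteq> {..<N}"
  shows "cdim (cspan (e ` I)) = enat (card I)"
proof -
  have "cdim (cspan (e ` I)) = enat (card (e ` I))"
    using biorthogonal_independent[OF assms] assms(2) finite_subset
    by (intro cdim_eq_card complex_vector.span_superset) auto
  also have "card (e ` I) = card I"
    using inj_on_subset[OF biorthogonal_inj[OF assms(1)] assms(2)] by (rule card_image)
  finally show ?thesis .
qed

text \<open>The vectors fixed by the coordinate map form a subspace that contains the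
  generators.\<close>

lemma biorthogonal_expansion:
  assumes "biorthogonal N e g" "I \<subseteq> {..<N}" "v \<in> cspan (e ` I)"
  shows "v = (\<Sum>i\<in>I. form v (g i) *\<^sub>C e i)"
proof -
  have fin: "finite I" using assms(2) by (rule finite_subset) simp
  define S where "S v = (\<Sum>i\<in>I. form v (g i) *\<^sub>C e i)" for v
  have "S 0 = 0" "S (x + y) = S x + S y" "S (c *\<^sub>C x) = c *\<^sub>C S x" for x y c
    by (simp_all add: S_def form.zero_left form.add_left form_scaleC_left scaleC_add_left sum.distrib
        complex_vector.scale_sum_right)
  then have "csubspace {v. v = S v}"
    by (intro complex_vector.subspaceI) auto
  then have "csubspace {v. v = (\<Sum>i\<in>I. form v (g i) *\<^sub>C e i)}" by (simp only: S_def)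
  moreover have "e ` I \<subseteq> {v. v = (\<Sum>i\<in>I. form v (g i) *\<^sub>C e i)}"
  proof (clarsimp)
    fix j assume j: "j \<in> I"
    have "(\<Sum>i\<in>I. form (e j) (g i) *\<^sub>C e i) = (\<Sum>i\<in>I. if i = j then e i else 0)"
    proof (intro sum.cong refl)
      fix i assume "i \<in> I"
      then have "form (e j) (g i) = (if j = i then 1 else 0)"
        using assms(1,2) j unfolding biorthogonal_def by blast
      then show "form (e j) (g i) *\<^sub>C e i = (if i = j then e i else 0)" by simp
    qed
    then show "e j = (\<Sum>i\<in>I. form (e j) (g i) *\<^sub>C e i)" using fin j by simp
  qed
  ultimately have "cspan (e ` I) \<subseteq> {v. v = (\<Sum>i\<in>I. form v (g i) *\<^sub>C e i)}"
    by (intro complex_vector.span_minimal)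
  then show ?thesis using assms(3) by blast
qed

lemma biorthogonal_span_coeff:
  assumes "biorthogonal N e g" "I \<subseteq> {..<N}" "v \<in> cspan (e ` I)" "j < N" "j \<notin> I"
  shows "form v (g j) = 0"
  by (subst biorthogonal_expansion[OF assms(1-3)])
    (simp add: biorthogonal_sum[OF assms(1,2,4)] assms(5))

text \<open>The source of finiteness: a span on which the form is nonpositive meets a subspace of
  positivity only in 0, so its dimension is bounded by the codimension of that subspace.\<close>

lemma biorthogonal_card_le:
  assumes "biorthogonal N e g" "I \<subseteq> {..<N}" "csubspace M" "finite B" "cspan (M \<union> B) = UNIV"
    and "cspan (e ` I) \<inter> M \<subseteq> {0}"
  shows "card I \<le> card B"
proof -
  have "cspan (e ` I) \<inter> M = {0}"
    using assms(3,6) complex_vector.span_zero complex_vector.subspace_0 by blast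
  then have "card (e ` I) \<le> card B"
    using complex_vector.independent_modulo_subspace_card_le[OF assms(3,4)
        biorthogonal_independent[OF assms(1,2)]] assms(5) by simp
  moreover have "card (e ` I) = card I"
    using inj_on_subset[OF biorthogonal_inj[OF assms(1)] assms(2)] by (rule card_image)
  ultimately show ?thesis by simp
qed

section \<open>The finite rank operator of a dual system\<close>

definition rank_op :: "nat \<Rightarrow> (nat \<Rightarrow> 'a) \<Rightarrow> 'a \<Rightarrow> 'a" where
  "rank_op N g x = (\<Sum>i<N. form x (g i) *\<^sub>C g i)"

lemma bounded_linear_coeff_sum:
  fixes e g :: "nat \<Rightarrow> 'a"
  shows "bounded_linear (\<lambda>x. \<Sum>i\<in>I. form x (g i) *\<^sub>C e i)"
proof (rule bounded_linear_sum)
  show "bounded_linear (\<lambda>x. form x (g i) *\<^sub>C e i)" for i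
    by (rule bounded_linear_compose[OF bounded_linear_scaleC_left[of "e i"] form.bounded_linear_left[of "g i"]])
qed

lemma rank_op_bounded_clinear: "bounded_clinear (rank_op N g)"
  unfolding bounded_clinear_def
proof (intro conjI allI)
  show "bounded_linear (rank_op N g)"
    unfolding rank_op_def[abs_def] by (rule bounded_linear_coeff_sum)
  show "rank_op N g (c *\<^sub>C x) = c *\<^sub>C rank_op N g x" for c x
    by (simp add: rank_op_def form_scaleC_left complex_vector.scale_sum_right)
qed

text \<open>Each \<open>g i\<close> serves both as functional and as value, which makes every
  summand symmetric.\<close>

lemma rank_op_symmetric: "G_symmetric G UNIV (rank_op N g)"
  unfolding G_symmetric_def
proof (intro ballI)
  fix x y
  have "form (rank_op N g x) y = (\<Sum>i<N. form x (g i) * form (g i) y)"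
    by (simp add: rank_op_def form.sum_left form_scaleC_left)
  also have "\<dots> = (\<Sum>i<N. cnj (form y (g i)) * form x (g i))"
    by (simp add: form_commute[of _ y] mult.commute)
  also have "\<dots> = form x (rank_op N g y)"
    by (simp add: rank_op_def form.sum_right form_scaleC_right)
  finally show "form (rank_op N g x) y = form x (rank_op N g y)" .
qed

text \<open>This recovers the coordinates of \<open>x\<close> from its perturbed image: pairing with
  a kernel vector \<open>e j\<close> removes the contribution of the unperturbed operator.\<close>

lemma rank_op_coeff:
  assumes "biorthogonal N e g" "j < N"
  shows "form (rank_op N g x) (e j) = form x (g j)"
  unfolding rank_op_def using biorthogonal_sum[OF biorthogonal_commute[OF assms(1)] order_refl assms(2)] assms(2)
  by simp

text \<open>The operator sends \<open>e j\<close> to \<open>g j\<close>, so every generator of the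
  span is attained.\<close>

lemma rank_op_range:
  assumes "biorthogonal N e g"
  shows "range (rank_op N g) = cspan (g ` {..<N})"
proof
  show "range (rank_op N g) \<subseteq> cspan (g ` {..<N})"
    unfolding rank_op_def
    by (intro image_subsetI, rule complex_vector.span_sum, rule complex_vector.span_scale,
        rule complex_vector.span_base) auto
  have b: "rank_op N g (x + y) = rank_op N g x + rank_op N g y"
    "rank_op N g (c *\<^sub>C x) = c *\<^sub>C rank_op N g x" "rank_op N g 0 = 0" for x y c
    using rank_op_bounded_clinear[of N g] unfolding bounded_clinear_def
    by (simp_all add: linear_simps)
  have "csubspace (range (rank_op N g))"
  proof (rule complex_vector.subspaceI)
    show "0 \<in> range (rank_op N g)" by (metis b(3) rangeI)
    show "x + y \<in> range (rank_op N g)"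
      if "x \<in> range (rank_op N g)" "y \<in> range (rank_op N g)" for x y
      using that b(1) by (auto intro: range_eqI[OF sym])
    show "c *\<^sub>C x \<in> range (rank_op N g)" if "x \<in> range (rank_op N g)" for c x
      using that b(2) by (auto intro: range_eqI[OF sym])
  qed
  moreover have "g ` {..<N} \<subseteq> range (rank_op N g)"
  proof
    fix v assume "v \<in> g ` {..<N}"
    then obtain j where j: "j < N" "v = g j" by blast
    have "rank_op N g (e j) = (\<Sum>i<N. if i = j then g i else 0)"
      unfolding rank_op_def using assms j(1) unfolding biorthogonal_def by (intro sum.cong) auto
    then have "v = rank_op N g (e j)" using j by simp
    then show "v \<in> range (rank_op N g)" by blast
  qed
  ultimately show "cspan (g ` {..<N}) \<subseteq> range (rank_op N g)"
    by (intro complex_vector.span_minimal)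
qed

section \<open>Inertia of fundamental decompositions\<close>

lemma isotropic_subspace:
  assumes "csubspace L" shows "csubspace (isotropic_part G L)"
  using assms unfolding isotropic_part_def
  by (intro complex_vector.subspaceI)
    (auto simp: complex_vector.subspace_0 complex_vector.subspace_add complex_vector.subspace_scale
      form.zero_left form.add_left form_scaleC_left)

lemma fundamental_decompositionD:
  assumes "fundamental_decomposition G L Lp Lm"
  shows "csubspace Lp" "\<forall>u\<in>Lp. u \<noteq> 0 \<longrightarrow> qform u > 0"
    and "csubspace Lm" "\<forall>v\<in>Lm. v \<noteq> 0 \<longrightarrow> qform v < 0"
    and "L = {u + v + w | u v w. u \<in> Lp \<and> v \<in> Lm \<and> w \<in> isotropic_part G L}"
  using assms
  unfolding fundamental_decomposition_def positive_subspace_def negative_subspace_def Let_def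
  by - (elim conjE, assumption)+

text \<open>One half of Sylvester's law of inertia. Modulo \<open>Lp\<close> plus the isotropic
  part, \<open>L\<close> is spanned by \<open>B\<close>; on that sum the form is nonnegative,
  whereas it is negative on nonzero vectors of the span of \<open>S\<close>, so the two meet only in
  0.\<close>

lemma fundamental_decomposition_negative_card_le:
  assumes L: "csubspace L" and d: "fundamental_decomposition G L Lp Lm"
    and d': "fundamental_decomposition G L Lp' Lm'"
    and B: "finite B" "Lm \<subseteq> cspan B" and S: "complex_vector.independent S" "S \<subseteq> Lm'"
  shows "finite S \<and> card S \<le> card B"
proof (rule complex_vector.independent_modulo_subspace_card_le[OF _ B(1) S(1)])
  let ?L0 = "isotropic_part G L"
  let ?Y = "{u + w | u w. u \<in> Lp \<and> w \<in> ?L0}"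
  note Lp = fundamental_decompositionD(1,2)[OF d] and Lm = fundamental_decompositionD(3)[OF d]
    and Leq = fundamental_decompositionD(5)[OF d] and Lp' = fundamental_decompositionD(1)[OF d']
    and Lm' = fundamental_decompositionD(3,4)[OF d'] and Leq' = fundamental_decompositionD(5)[OF d']
  show "csubspace ?Y"
    by (rule complex_vector.subspace_sums[OF Lp(1) isotropic_subspace[OF L]])
  show "S \<subseteq> cspan (?Y \<union> B)"
  proof
    fix x assume "x \<in> S"
    then have "0 + x + 0 \<in> L"
      using S(2) complex_vector.subspace_0[OF Lp'] complex_vector.subspace_0[OF isotropic_subspace[OF L]]
      by (subst Leq') blast
    then have "x \<in> {u + v + w | u v w. u \<in> Lp \<and> v \<in> Lm \<and> w \<in> ?L0}"
      by (subst (asm) Leq) simp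
    then obtain u v w where x: "x = u + v + w" "u \<in> Lp" "v \<in> Lm" "w \<in> ?L0"
      by blast
    have "u + w \<in> cspan (?Y \<union> B)"
      using x by (intro complex_vector.span_base) blast
    moreover have "v \<in> cspan (?Y \<union> B)"
      using x(3) B(2) complex_vector.span_mono[of B "?Y \<union> B"] by blast
    moreover have "x = (u + w) + v" using x(1) by simp
    ultimately show "x \<in> cspan (?Y \<union> B)" by (simp only: complex_vector.span_add)
  qed
  have "x = 0" if xS: "x \<in> cspan S" and xY: "x \<in> ?Y" for x
  proof (rule ccontr)
    assume "x \<noteq> 0"
    have "cspan S \<subseteq> Lm'" using S(2) Lm'(1) by (rule complex_vector.span_minimal)
    then have "qform x < 0" using xS Lm'(2) \<open>x \<noteq> 0\<close> by blast
    moreover obtain u w where x: "x = u + w" "u \<in> Lp" "w \<in> ?L0" using xY by blast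
    have "u + 0 + 0 \<in> L"
      using x(2) complex_vector.subspace_0[OF Lm] complex_vector.subspace_0[OF isotropic_subspace[OF L]]
      by (subst Leq) blast
    then have "form w u = 0" "form w w = 0" using x(3) unfolding isotropic_part_def by auto
    then have "qform x = qform u" unfolding x(1) qform_add using form_commute[of u w] by simp
    moreover have "qform u \<ge> 0" using Lp(2) x(2) by (cases "u = 0") (auto simp: form.zero_left)
    ultimately show False by simp
  qed
  moreover have "0 \<in> ?Y" using \<open>csubspace ?Y\<close> by (rule complex_vector.subspace_0)
  ultimately show "cspan S \<inter> ?Y = {0}"
    using complex_vector.span_zero by (intro equalityI subsetI) auto
qed

text \<open>Justifies the definite description when one negative part is finite-dimensional: the
  inertia bound, used in both directions, gives every other negative part the same
  dimension.\<close>

lemma kappa_minus_eq: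
  assumes L: "csubspace L" and d: "fundamental_decomposition G L Lp Lm"
    and B: "finite B" "complex_vector.independent B" "Lm = cspan B"
  shows "kappa_minus G L = enat (card B)"
  unfolding kappa_minus_def
proof (rule the_equality)
  have BLm: "B \<subseteq> Lm" using B(3) complex_vector.span_superset by blast
  show "\<exists>Lp Lm. fundamental_decomposition G L Lp Lm \<and> enat (card B) = cdim Lm"
    using d cdim_eq_card[OF B(2,1) BLm] B(3) by (intro exI[of _ Lp] exI[of _ Lm]) auto
  fix c assume "\<exists>Lp Lm. fundamental_decomposition G L Lp Lm \<and> c = cdim Lm"
  then obtain Lp' Lm' where d': "fundamental_decomposition G L Lp' Lm'" "c = cdim Lm'" by blast
  obtain S where S: "S \<subseteq> Lm'" "complex_vector.independent S" "Lm' \<subseteq> cspan S"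
    using complex_vector.maximal_independent_subset by blast
  have 1: "finite S \<and> card S \<le> card B"
    using fundamental_decomposition_negative_card_le[OF L d d'(1) B(1) _ S(2,1)] B(3) by blast
  then have "card B \<le> card S"
    using fundamental_decomposition_negative_card_le[OF L d'(1) d _ S(3) B(2) BLm] by blast
  then show "c = enat (card B)"
    using 1 cdim_eq_card[OF S(2) _ S(1,3)] d'(2) by simp
qed

end

lemma maximal_nat_bounded:
  fixes P :: "nat \<Rightarrow> bool"
  assumes "P 0" "\<And>n. P n \<Longrightarrow> n \<le> N"
  obtains n where "P n" "\<not> P (Suc n)"
  using assms by (metis Suc_n_not_le_n nat_induct)

section \<open>Dual systems for an injective operator\<close>

locale nondegenerate_form = bounded_form +
  assumes injective: "0 \<notin> sigma_p UNIV G"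
begin

text \<open>Injectivity enters here: \<open>form x (G x)\<close> is the squared norm of
  \<open>G x\<close>, hence nonzero, so a multiple of \<open>G x\<close> pairs with \<open>x\<close>
  to 1.\<close>

lemma biorthogonal_extend:
  assumes b: "biorthogonal N e g" and x: "x \<noteq> 0" "\<And>j. j < N \<Longrightarrow> form x (g j) = 0"
  obtains y where "biorthogonal (Suc N) (e(N := x)) (g(N := y))"
proof -
  have "G x \<noteq> 0" using injective x(1) unfolding sigma_p_def by auto
  then have "form x (G x) \<noteq> 0" by (simp add: gform_def cinner_self)
  define y0 where "y0 = cnj (inverse (form x (G x))) *\<^sub>C G x"
  have y0: "form x y0 = 1" using \<open>form x (G x) \<noteq> 0\<close> by (simp add: y0_def form_scaleC_right)
  \<comment> \<open>The correction makes \<open>y\<close> orthogonal to the old \<open>e i\<close>;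
    it keeps \<open>form x y = 1\<close> because \<open>x\<close> is orthogonal to the old
    \<open>g i\<close>.\<close>
  define y where "y = y0 - (\<Sum>i<N. form y0 (e i) *\<^sub>C g i)"
  have "form x y = 1"
    unfolding y_def using x(2) y0 by (simp add: form.diff_right form.sum_right form_scaleC_right)
  moreover have "form (e i) y = 0" if "i < N" for i
  proof -
    have "form y (e i) = 0" unfolding y_def form.diff_left
      using biorthogonal_sum[OF biorthogonal_commute[OF b] order_refl that] that by simp
    then show ?thesis using form_commute[of "e i" y] by simp
  qed
  ultimately have "biorthogonal (Suc N) (e(N := x)) (g(N := y))"
    using b x(2) unfolding biorthogonal_def by (auto simp: less_Suc_eq)
  then show ?thesis by (rule that)
qed

text \<open>The system lists first a basis of a negative part of \<open>L\<close> and then one of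
  the isotropic part. The vectors of \<open>L\<close> with vanishing coordinates form the positive
  part, so all three parts of a fundamental decomposition are at hand and the length of the system
  is the required index.\<close>

lemma finite_nonpositive_part:
  assumes L: "csubspace L" "closed L" and M: "csubspace M" "finite_codim M"
    and pos: "\<And>x. \<lbrakk>x \<in> L; x \<in> M; x \<noteq> 0\<rbrakk> \<Longrightarrow> qform x > 0"
  obtains N e g where "biorthogonal N e g" "\<And>i. i < N \<Longrightarrow> e i \<in> L"
    "\<And>x. \<lbrakk>x \<in> L; \<And>i. i < N \<Longrightarrow> form x (g i) = 0; x \<noteq> 0\<rbrakk> \<Longrightarrow> qform x > 0"
    "kappa_minus_zero G L = enat N"
proof -
  obtain B where B: "finite B" "cspan (M \<union> B) = UNIV" using M(2) unfolding finite_codim_def by blast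
  let ?L0 = "isotropic_part G L"
  have L0: "csubspace ?L0" using L(1) by (rule isotropic_subspace)
  \<comment> \<open>For orthonormal negative vectors \<open>f i\<close> the dual of
    \<open>- f i\<close> is \<open>f i\<close> itself, which explains the sign in
    \<open>e i = - f i\<close>. The length \<open>n\<close> is kept apart from \<open>N\<close> to
    cover the system before and after isotropic vectors are appended.\<close>
  have neg_span: "form v v = - complex_of_real (\<Sum>i<n. (cmod (form v (f i)))\<^sup>2)"
    if b: "biorthogonal N e g" and n: "n \<le> N" "\<And>i. i < n \<Longrightarrow> e i = - f i \<and> g i = f i"
      and v: "v \<in> cspan (e ` {..<n})" for N n e g f v
  proof -
    have "form v v = form (\<Sum>i<n. form v (g i) *\<^sub>C e i) v"
      using biorthogonal_expansion[OF b _ v] n(1) by simp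
    also have "\<dots> = (\<Sum>i<n. form v (g i) * form (e i) v)"
      by (simp add: form.sum_left form_scaleC_left)
    also have "\<dots> = (\<Sum>i<n. - complex_of_real ((cmod (form v (f i)))\<^sup>2))"
    proof (rule sum.cong[OF refl])
      fix i assume "i \<in> {..<n}"
      then have "form v (g i) * form (e i) v = - (form v (f i) * cnj (form v (f i)))"
        using n(2)[of i] form_commute[of "f i" v] by (simp add: form.minus_left)
      also have "\<dots> = - complex_of_real ((cmod (form v (f i)))\<^sup>2)"
        using complex_norm_square[of "form v (f i)"] by simp
      finally show "form v (g i) * form (e i) v = - complex_of_real ((cmod (form v (f i)))\<^sup>2)" .
    qed
    finally show ?thesis by (simp add: sum_negf)
  qed
  have neg_less: "qform v < 0"
    if b: "biorthogonal N e g" and n: "n \<le> N" "\<And>i. i < n \<Longrightarrow> e i = - f i \<and> g i = f i"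
      and v: "v \<in> cspan (e ` {..<n})" "v \<noteq> 0" for N n e g f v
  proof -
    have "\<exists>i<n. form v (f i) \<noteq> 0"
    proof (rule ccontr)
      assume "\<not> ?thesis"
      then have "(\<Sum>i<n. form v (g i) *\<^sub>C e i) = 0" using n(2) by simp
      then show False using biorthogonal_expansion[OF b _ v(1)] n(1) v(2) by simp
    qed
    then obtain i where "i < n" "form v (f i) \<noteq> 0" by blast
    then have "(\<Sum>i<n. (cmod (form v (f i)))\<^sup>2) > 0"
      by (intro sum_pos2[where i = i]) auto
    then show ?thesis using neg_span[OF b n v(1)] by simp
  qed

  \<comment> \<open>\<open>P n\<close> says that \<open>L\<close> contains \<open>n\<close>
    orthonormal negative vectors. Their span is negative and so misses \<open>M\<close>, which
    bounds \<open>n\<close>.\<close>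
  define P where "P n \<longleftrightarrow> (\<exists>f. \<forall>i<n. f i \<in> L \<and> (\<forall>j<n. form (f i) (f j) = (if i = j then - 1 else 0)))"
    for n :: nat
  have P_bound: "n \<le> card B" if Pn: "P n" for n
  proof -
    obtain f where f: "\<forall>i<n. f i \<in> L \<and> (\<forall>j<n. form (f i) (f j) = (if i = j then - 1 else 0))"
      using Pn unfolding P_def by blast
    have b: "biorthogonal n (\<lambda>i. - f i) f"
      using f unfolding biorthogonal_def by (auto simp: form.minus_left)
    have "cspan ((\<lambda>i. - f i) ` {..<n}) \<subseteq> L"
      using f L(1) by (intro complex_vector.span_minimal) (auto simp: complex_vector.subspace_neg)
    then have "cspan ((\<lambda>i. - f i) ` {..<n}) \<inter> M \<subseteq> {0}"
      using neg_less[OF b order_refl, of f] pos by force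
    then have "card {..<n} \<le> card B"
      using biorthogonal_card_le[OF b order_refl M(1) B] by blast
    then show ?thesis by simp
  qed
  obtain n where n: "P n" "\<not> P (Suc n)"
    using maximal_nat_bounded[of P "card B"] P_bound by (auto simp: P_def)
  obtain f where "\<forall>i<n. f i \<in> L \<and> (\<forall>j<n. form (f i) (f j) = (if i = j then - 1 else 0))"
    using n(1) unfolding P_def by blast
  then have f: "\<And>i. i < n \<Longrightarrow> f i \<in> L"
    "\<And>i j. i < n \<Longrightarrow> j < n \<Longrightarrow> form (f i) (f j) = (if i = j then - 1 else 0)"
    by blast+
  \<comment> \<open>A negative vector orthogonal to all \<open>f j\<close> could be normalised to
    \<open>- 1\<close> and appended, against the maximality of \<open>n\<close>.\<close>
  have nonneg: "qform x \<ge> 0" if x: "x \<in> L" "\<And>j. j < n \<Longrightarrow> form x (f j) = 0" for x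
  proof (rule ccontr)
    assume "\<not> qform x \<ge> 0"
    define y where "y = (1 / sqrt (- qform x)) *\<^sub>R x"
    have "qform y = - 1"
      unfolding y_def qform_scaleR using \<open>\<not> qform x \<ge> 0\<close> by (simp add: power_divide field_simps)
    then have y: "form y y = - 1" using form_self[of y] by simp
    have yf: "form y (f j) = 0" "form (f j) y = 0" if "j < n" for j
      using x(2)[OF that] form_commute[of "f j" x] by (simp_all add: y_def form.scaleR_left form.scaleR_right)
    have "y \<in> L" unfolding y_def using L(1) x(1) by (rule csubspace_scaleR)
    then have "P (Suc n)"
      unfolding P_def using f y yf by (intro exI[of _ "f(n := y)"]) (auto simp: less_Suc_eq)
    then show False using n(2) by contradiction
  qed

  \<comment> \<open>\<open>Q k\<close> says that the negative system can be prolonged by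
    \<open>k\<close> isotropic vectors while its first \<open>n\<close> duals are kept.\<close>
  define Q where "Q k \<longleftrightarrow> (\<exists>e g. biorthogonal (n + k) e g \<and> (\<forall>i<n. e i = - f i \<and> g i = f i)
      \<and> (\<forall>i. n \<le> i \<longrightarrow> i < n + k \<longrightarrow> e i \<in> ?L0))" for k
  have Q_bound: "k \<le> card B" if "Q k" for k
  proof -
    obtain e g where b: "biorthogonal (n + k) e g" and e: "e ` {n..<n + k} \<subseteq> ?L0"
      using \<open>Q k\<close> unfolding Q_def by force
    have "cspan (e ` {n..<n + k}) \<subseteq> ?L0" using e L0 by (rule complex_vector.span_minimal)
    moreover have "?L0 \<inter> M \<subseteq> {0}" using pos unfolding isotropic_part_def by force
    ultimately have "card {n..<n + k} \<le> card B"
      using biorthogonal_card_le[OF b _ M(1) B, of "{n..<n + k}"] by fastforce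
    then show ?thesis by simp
  qed
  have "biorthogonal n (\<lambda>i. - f i) f"
    using f unfolding biorthogonal_def by (auto simp: form.minus_left)
  then have "Q 0" unfolding Q_def by (intro exI[of _ "\<lambda>i. - f i"] exI[of _ f]) auto
  then obtain k where k: "Q k" "\<not> Q (Suc k)"
    using maximal_nat_bounded[of Q "card B"] Q_bound by blast
  obtain e g where b: "biorthogonal (n + k) e g"
    and ef: "\<And>i. i < n \<Longrightarrow> e i = - f i \<and> g i = f i"
    and e0: "\<And>i. n \<le> i \<Longrightarrow> i < n + k \<Longrightarrow> e i \<in> ?L0"
    using k(1) unfolding Q_def by blast
  \<comment> \<open>A nonzero isotropic vector with vanishing coordinates could be appended, against
    the maximality of \<open>k\<close>.\<close>
  have L0_zero: "x = 0" if x: "x \<in> ?L0" "\<And>j. j < n + k \<Longrightarrow> form x (g j) = 0" for x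
  proof (rule ccontr)
    assume "x \<noteq> 0"
    then obtain y where "biorthogonal (Suc (n + k)) (e(n + k := x)) (g(n + k := y))"
      using biorthogonal_extend[OF b _ x(2)] by blast
    then have "Q (Suc k)"
      unfolding Q_def using ef e0 x(1)
      by (intro exI[of _ "e(n + k := x)"] exI[of _ "g(n + k := y)"]) (auto simp: less_Suc_eq)
    then show False using k(2) by contradiction
  qed
  have eL: "e i \<in> L" if "i < n + k" for i
  proof (cases "i < n")
    case True
    then show ?thesis using ef f(1) L(1) by (simp add: complex_vector.subspace_neg)
  next
    case False
    then show ?thesis using e0 that unfolding isotropic_part_def by auto
  qed
  have spanL: "cspan (e ` I) \<subseteq> L" if "I \<subseteq> {..<n + k}" for I
    using eL that L(1) by (intro complex_vector.span_minimal) auto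
  \<comment> \<open>\<open>pm\<close> and \<open>pz\<close> are the coordinate projections onto the
    negative and the isotropic span. They are bounded on the whole space, which later yields
    closedness and the bounds on the decomposition.\<close>
  define pm where "pm x = (\<Sum>i<n. form x (g i) *\<^sub>C e i)" for x
  define pz where "pz x = (\<Sum>i=n..<n + k. form x (g i) *\<^sub>C e i)" for x
  have pm_span: "pm x \<in> cspan (e ` {..<n})" for x
    unfolding pm_def
    by (rule complex_vector.span_sum, rule complex_vector.span_scale,
        rule complex_vector.span_base) auto
  have pz_span: "pz x \<in> cspan (e ` {n..<n + k})" for x
    unfolding pz_def
    by (rule complex_vector.span_sum, rule complex_vector.span_scale,
        rule complex_vector.span_base) auto
  have pm_coeff: "form (pm x) (g j) = (if j < n then form x (g j) else 0)" if "j < n + k" for x j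
    unfolding pm_def using biorthogonal_sum[OF b _ that, of "{..<n}" "\<lambda>i. form x (g i)"] by auto
  have pz_coeff: "form (pz x) (g j) = (if n \<le> j then form x (g j) else 0)" if "j < n + k" for x j
  proof -
    have "{n..<n + k} \<subseteq> {..<n + k}" by auto
    then show ?thesis
      unfolding pz_def using biorthogonal_sum[OF b _ that, of "{n..<n + k}" "\<lambda>i. form x (g i)"] that
      by simp
  qed
  have pz_L0: "pz x \<in> ?L0" for x
    using pz_span[of x] complex_vector.span_minimal[OF _ L0, of "e ` {n..<n + k}"] e0 by fastforce
  have L0_f: "form x (f j) = 0" "form (f j) x = 0" if "x \<in> ?L0" "j < n" for x j
    using that f(1) form_commute[of "f j" x] unfolding isotropic_part_def by auto
  have L0_expand: "pz x = x" if "x \<in> ?L0" for x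
  proof -
    have "x - pz x = 0"
    proof (rule L0_zero)
      show "x - pz x \<in> ?L0" using L0 that pz_L0 by (rule complex_vector.subspace_diff)
      fix j assume j: "j < n + k"
      then show "form (x - pz x) (g j) = 0"
        using pz_coeff[OF j, of x] L0_f(1)[OF that, of j] ef by (cases "j < n") (auto simp: form.diff_left)
    qed
    then show ?thesis by simp
  qed
  then have L0_span: "?L0 = cspan (e ` {n..<n + k})"
    using pz_span pz_L0 complex_vector.span_minimal[OF _ L0, of "e ` {n..<n + k}"] e0
    by (intro equalityI subsetI) (metis, fastforce)

  let ?Lm = "cspan (e ` {..<n})"
  define Lp where "Lp = {x \<in> L. \<forall>j<n + k. form x (g j) = 0}"
  \<comment> \<open>The form is nonnegative on \<open>?L1\<close>, so a null vector of
    \<open>Lp\<close> is orthogonal to \<open>?L1\<close>. It is also orthogonal to the negative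
    span, and these two fill \<open>L\<close>; hence it is isotropic, and its coordinates
    vanish.\<close>
  have Lp_pos: "qform x > 0" if "x \<in> Lp" "x \<noteq> 0" for x
  proof -
    let ?L1 = "{x \<in> L. \<forall>j<n. form x (f j) = 0}"
    have L1: "csubspace ?L1"
      using L(1) by (intro complex_vector.subspaceI)
        (auto simp: complex_vector.subspace_0 complex_vector.subspace_add
          complex_vector.subspace_scale form.zero_left form.add_left form_scaleC_left)
    have "form x (f j) = 0" if "j < n" for j
      using \<open>x \<in> Lp\<close> ef[OF that] that unfolding Lp_def
      by (metis (mono_tags, lifting) mem_Collect_eq trans_less_add1)
    then have xL1: "x \<in> ?L1" using that(1) unfolding Lp_def by blast
    have nn: "qform x \<ge> 0" using xL1 nonneg by blast
    moreover have "qform x \<noteq> 0"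
    proof
      assume x0: "qform x = 0"
      have "form x y = 0" if y: "y \<in> L" for y
      proof -
        have "y - pm y \<in> ?L1"
        proof -
          have "form (y - pm y) (f j) = 0" if "j < n" for j
            using pm_coeff[of j y] that ef by (simp add: form.diff_left)
          then show ?thesis
            using y pm_span[of y] spanL[of "{..<n}"] L(1) by (auto simp: complex_vector.subspace_diff)
        qed
        then have "form x (y - pm y) = 0"
          using nonneg_null_isotropic[OF L1 _ xL1 x0] nonneg by blast
        moreover have "form x (pm y) = 0"
          unfolding pm_def form.sum_right form_scaleC_right
          using xL1 ef by (intro sum.neutral) (auto simp: form.minus_right)
        ultimately show ?thesis by (simp add: form.diff_right)
      qed
      then have "x \<in> ?L0" using xL1 unfolding isotropic_part_def by blast
      then have "x = 0" using L0_zero that(1) unfolding Lp_def by blast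
      then show False using that(2) by contradiction
    qed
    ultimately show ?thesis by simp
  qed
  have Lp_sub: "csubspace Lp"
    unfolding Lp_def using L(1) by (intro complex_vector.subspaceI)
        (auto simp: complex_vector.subspace_0 complex_vector.subspace_add
          complex_vector.subspace_scale form.zero_left form.add_left form_scaleC_left)
  have Lp_closed: "closed Lp"
  proof -
    have "Lp = L \<inter> (\<Inter>j\<in>{..<n + k}. {x. form x (g j) = 0})" unfolding Lp_def by auto
    moreover have "closed {x. form x (g j) = 0}" for j
      by (intro closed_Collect_eq continuous_intros
          bounded_linear.continuous_on[OF form.bounded_linear_left])
    ultimately show ?thesis using L(2) by auto
  qed
  have bl_pm: "bounded_linear pm" and bl_pz: "bounded_linear pz"
    unfolding pm_def[abs_def] pz_def[abs_def] by (rule bounded_linear_coeff_sum)+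
  have pm_fix: "pm v = v" if "v \<in> ?Lm" for v
    using biorthogonal_expansion[OF b _ that] unfolding pm_def by simp
  have Lm_closed: "closed ?Lm"
  proof -
    have "?Lm = {x. pm x = x}" using pm_fix pm_span by (metis (mono_tags) Collect_eqI Collect_mem_eq)
    moreover have "closed {x. pm x = x}"
      by (intro closed_Collect_eq continuous_intros bounded_linear.continuous_on[OF bl_pm])
    ultimately show ?thesis by simp
  qed
  obtain Km where Km: "\<And>x. norm (pm x) \<le> norm x * Km" "Km > 0"
    using bounded_linear.pos_bounded[OF bl_pm] by blast
  obtain Kz where Kz: "\<And>x. norm (pz x) \<le> norm x * Kz" "Kz > 0"
    using bounded_linear.pos_bounded[OF bl_pz] by blast
  let ?K = "1 + Km + Kz"
  \<comment> \<open>\<open>pm\<close> and \<open>pz\<close> recover \<open>v\<close> and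
    \<open>w\<close> from the sum, and \<open>u\<close> is what remains.\<close>
  have bd: "norm u \<le> ?K * norm (u + v + w) \<and> norm v \<le> ?K * norm (u + v + w)
      \<and> norm w \<le> ?K * norm (u + v + w)"
    if u: "u \<in> Lp" and v: "v \<in> ?Lm" and w: "w \<in> ?L0" for u v w
  proof -
    let ?x = "u + v + w"
    have c: "form ?x (g j) = form v (g j) + form w (g j)" if "j < n + k" for j
      using u that unfolding Lp_def by (simp add: form.add_left)
    have "pm ?x = pm v"
      unfolding pm_def
    proof (intro sum.cong refl)
      fix i assume "i \<in> {..<n}"
      then have "form ?x (g i) = form v (g i)"
        using c[of i] L0_f(1)[OF w, of i] ef[of i] by simp
      then show "form ?x (g i) *\<^sub>C e i = form v (g i) *\<^sub>C e i" by simp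
    qed
    then have v': "pm ?x = v" using pm_fix[OF v] by simp
    have "pz ?x = pz w"
      unfolding pz_def
    proof (intro sum.cong refl)
      fix i assume "i \<in> {n..<n + k}"
      then have "form ?x (g i) = form w (g i)"
        using c[of i] biorthogonal_span_coeff[OF b _ v, of i] by simp
      then show "form ?x (g i) *\<^sub>C e i = form w (g i) *\<^sub>C e i" by simp
    qed
    then have w': "pz ?x = w" using L0_expand[OF w] by simp
    have nv: "norm v \<le> Km * norm ?x" and nw: "norm w \<le> Kz * norm ?x"
      using Km(1)[of ?x] Kz(1)[of ?x] v' w' by (simp_all add: mult.commute)
    have "norm u \<le> norm ?x + norm v + norm w"
      using norm_triangle_ineq4[of "?x - v" w] norm_triangle_ineq4[of ?x v] by simp
    moreover have "0 \<le> Km * norm ?x" "0 \<le> Kz * norm ?x" "0 \<le> norm ?x" using Km(2) Kz(2) by simp_all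
    ultimately show ?thesis using nv nw unfolding distrib_right mult_1 by linarith
  qed
  have fd: "fundamental_decomposition G L Lp ?Lm"
    unfolding fundamental_decomposition_def Let_def
  proof (intro conjI)
    show "positive_subspace G Lp"
      unfolding positive_subspace_def using Lp_sub Lp_closed Lp_pos by blast
    show "negative_subspace G ?Lm"
      unfolding negative_subspace_def
      using Lm_closed neg_less[OF b le_add1 ef] by simp
    have "form u (e i) = 0" if "u \<in> Lp" "i < n" for u i
    proof -
      have "form u (g i) = 0" using that unfolding Lp_def by simp
      then show ?thesis using ef[OF that(2)] by (simp add: form.minus_right)
    qed
    then have "form u (pm v) = 0" if "u \<in> Lp" for u v
      unfolding pm_def form.sum_right form_scaleC_right using that by (intro sum.neutral) auto
    then show "G_orthogonal G Lp ?Lm" unfolding G_orthogonal_def using pm_fix by metis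
    have "form x w = 0" if "x \<in> L" "w \<in> ?L0" for x w
      using that form_commute[of x w] unfolding isotropic_part_def by simp
    then show "G_orthogonal G Lp ?L0" "G_orthogonal G ?Lm ?L0"
      unfolding G_orthogonal_def using spanL[of "{..<n}"] by (auto simp: Lp_def)
    show "L = {u + v + w |u v w. u \<in> Lp \<and> v \<in> ?Lm \<and> w \<in> ?L0}"
    proof (intro equalityI subsetI)
      fix x assume x: "x \<in> L"
      define u where "u = x - pm x - pz x"
      have "u \<in> L" unfolding u_def
        using L(1) x pm_span[of x] pz_L0[of x] spanL[of "{..<n}"]
        by (auto simp: complex_vector.subspace_diff isotropic_part_def)
      moreover have "form u (g j) = 0" if "j < n + k" for j
        unfolding u_def using pm_coeff[OF that, of x] pz_coeff[OF that, of x]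
        by (auto simp: form.diff_left)
      ultimately have "u \<in> Lp" unfolding Lp_def by blast
      moreover have "x = u + pm x + pz x" by (simp add: u_def)
      ultimately show "x \<in> {u + v + w |u v w. u \<in> Lp \<and> v \<in> ?Lm \<and> w \<in> ?L0}"
        using pm_span pz_L0 by blast
    next
      fix x assume "x \<in> {u + v + w |u v w. u \<in> Lp \<and> v \<in> ?Lm \<and> w \<in> ?L0}"
      then show "x \<in> L"
        using L(1) spanL[of "{..<n}"]
        by (auto simp: Lp_def isotropic_part_def intro!: complex_vector.subspace_add)
    qed
    show "\<forall>u\<in>Lp. \<forall>v\<in>?Lm. \<forall>w\<in>?L0. u + v + w = 0 \<longrightarrow> u = 0 \<and> v = 0 \<and> w = 0"
      using bd by (metis mult_zero_right norm_eq_zero norm_le_zero_iff)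
    show "\<exists>K. \<forall>u\<in>Lp. \<forall>v\<in>?Lm. \<forall>w\<in>?L0. norm u \<le> K * norm (u + v + w) \<and>
        norm v \<le> K * norm (u + v + w) \<and> norm w \<le> K * norm (u + v + w)"
      using bd by blast
  qed
  have "kappa_minus G L = enat (card (e ` {..<n}))"
    using fd biorthogonal_independent[OF b, of "{..<n}"] by (intro kappa_minus_eq[OF L(1)]) auto
  also have "card (e ` {..<n}) = n"
    using inj_on_subset[OF biorthogonal_inj[OF b], of "{..<n}"] by (simp add: card_image)
  finally have km: "kappa_minus G L = enat n" .
  have "kappa_zero G L = enat k"
    unfolding kappa_zero_def L0_span
    using biorthogonal_cdim[OF b, of "{n..<n + k}"] by (simp add: subset_iff)
  then have "kappa_minus_zero G L = enat (n + k)"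
    unfolding kappa_minus_zero_def km by simp
  then show ?thesis
    using that[OF b] eL Lp_pos unfolding Lp_def by blast
qed


section \<open>The finite rank perturbation\<close>

text \<open>If the inequality failed for the constants \<open>n\<close> and
  \<open>inverse (Suc n)\<close>, normalised counterexamples would form an approximate eigensequence
  in \<open>M\<close> along which \<open>qform\<close> has lower limit at most 0.\<close>

lemma coercive_on_of_pos_type:
  assumes lin: "linear_operator D T" and T: "\<And>x. T x = A x - \<mu> *\<^sub>C x"
    and M: "csubspace M" "pos_type_on G D A \<mu> M"
  shows "coercive_on T (D \<inter> M)"
proof (rule ccontr)
  assume neg: "\<not> coercive_on T (D \<inter> M)"
  have "\<exists>x. x \<in> D \<inter> M \<and> norm x = 1 \<and> qform x + real n * (norm (T x))\<^sup>2 < inverse (real (Suc n))" for n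
  proof -
    have "\<exists>x\<in>D \<inter> M. qform x + real n * (norm (T x))\<^sup>2 < inverse (real (Suc n)) * (norm x)\<^sup>2"
      using neg unfolding coercive_on_def by (meson inverse_positive_iff_positive not_le of_nat_0_less_iff zero_less_Suc)
    then obtain x where x: "x \<in> D \<inter> M"
      "qform x + real n * (norm (T x))\<^sup>2 < inverse (real (Suc n)) * (norm x)\<^sup>2" by blast
    have "x \<noteq> 0" using x(2) linear_operator_zero[OF lin] by (auto simp: form.zero_left)
    define y where "y = (1 / norm x) *\<^sub>R x"
    have "y \<in> D \<inter> M" unfolding y_def using x(1) M(1) lin
      by (auto intro!: csubspace_scaleR simp: linear_operator_def)
    moreover have "norm y = 1" using \<open>x \<noteq> 0\<close> by (simp add: y_def)
    moreover have "qform y + real n * (norm (T y))\<^sup>2 = (qform x + real n * (norm (T x))\<^sup>2) / (norm x)\<^sup>2"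
      unfolding y_def using linear_operator_scaleR[OF lin, of x] x(1)
      by (simp add: qform_scaleR power_divide add_divide_distrib)
    moreover have "\<dots> < inverse (real (Suc n))"
      using x(2) \<open>x \<noteq> 0\<close> by (simp add: pos_divide_less_eq)
    ultimately show ?thesis by (metis (no_types, lifting))
  qed
  then obtain x where x: "\<And>n. x n \<in> D \<inter> M" "\<And>n. norm (x n) = 1"
    "\<And>n. qform (x n) + real n * (norm (T (x n)))\<^sup>2 < inverse (real (Suc n))" by metis
  obtain K where K: "K > 0" "\<And>x. \<bar>qform x\<bar> \<le> K * (norm x)\<^sup>2" using qform_le by blast
  have "(\<lambda>n. T (x n)) \<longlonglongrightarrow> 0"
  proof (rule Lim_null_comparison)
    \<comment> \<open>On unit vectors \<open>qform\<close> is at least \<open>- K\<close>, so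
      \<open>n\<close> times the squared norm of \<open>T (x n)\<close> is at most
      \<open>K + 1\<close>.\<close>
    have "norm (T (x n)) \<le> sqrt ((K + 1) / real n)" if n: "n > 0" for n
    proof -
      have "inverse (real (Suc n)) \<le> 1" by (simp add: inverse_eq_divide)
      then have "real n * (norm (T (x n)))\<^sup>2 \<le> K + 1"
        using x(3)[of n] K(2)[of "x n"] x(2)[of n] by simp
      then show ?thesis using n by (intro real_le_rsqrt) (simp add: field_simps)
    qed
    then show "\<forall>\<^sub>F n in sequentially. norm (T (x n)) \<le> sqrt ((K + 1) / real n)"
      by (intro eventually_mono[OF eventually_gt_at_top[of "0::nat"]])
    have "(\<lambda>n. sqrt ((K + 1) / real n)) \<longlonglongrightarrow> sqrt 0"
      by (intro tendsto_intros lim_const_over_n)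
    then show "(\<lambda>n. sqrt ((K + 1) / real n)) \<longlonglongrightarrow> 0" by simp
  qed
  then have "approx_eigenseq D A \<mu> x" "range x \<subseteq> M"
    unfolding approx_eigenseq_def using x(1,2) T by auto
  then have "0 < liminf (\<lambda>n. ereal (qform (x n)))" using M(2) unfolding pos_type_on_def by blast
  also have "\<dots> \<le> liminf (\<lambda>n. ereal (inverse (real (Suc n))))"
  proof (intro Liminf_mono always_eventually allI)
    fix n
    have "0 \<le> real n * (norm (T (x n)))\<^sup>2" by simp
    then show "ereal (qform (x n)) \<le> ereal (inverse (real (Suc n)))"
      using x(3)[of n] by (simp only: ereal_less_eq)
  qed
  also have "\<dots> = ereal 0"
    by (intro lim_imp_Liminf tendsto_ereal LIMSEQ_inverse_real_of_nat) simp
  finally show False by simp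
qed

text \<open>Positive type on \<open>UNIV\<close> covers both alternatives for the perturbed
  operator: it holds vacuously when \<open>\<mu>\<close> is not an approximate eigenvalue.\<close>

lemma finite_rank_perturbation:
  assumes A: "closed_operator D A" "G_symmetric G D A" and \<mu>: "\<mu> \<in> \<real>"
    and M: "csubspace M" "finite_codim M" "pos_type_on G D A \<mu> M"
  shows "\<exists>F. bounded_clinear F \<and> finite_rank F \<and> G_symmetric G UNIV F \<and>
    pos_type_on G D (\<lambda>x. A x + F x) \<mu> UNIV \<and>
    cdim (range F) = kappa_minus_zero G (eigenspace D A \<mu>)"
proof -
  define T where "T x = A x - \<mu> *\<^sub>C x" for x
  have linA: "linear_operator D A" and clA: "closed {(x, A x) |x. x \<in> D}"
    using A(1) unfolding closed_operator_def by auto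
  have D: "csubspace D" using linA by (simp add: linear_operator_def)
  have lin: "linear_operator D T"
    using linA unfolding linear_operator_def T_def
    by (auto simp: scaleC_add_right complex_vector.scale_right_diff_distrib mult.commute)
  have T_sym: "form (T x) y = form x (T y)" if "x \<in> D" "y \<in> D" for x y
  proof -
    have "cnj \<mu> = \<mu>" using \<mu> by (simp add: Reals_cnj_iff)
    moreover have "form (A x) y = form x (A y)" using A(2) that unfolding G_symmetric_def by blast
    ultimately show ?thesis
      by (simp add: T_def form.diff_left form.diff_right form_scaleC_left form_scaleC_right)
  qed
  \<comment> \<open>Along such a sequence \<open>A (s n)\<close> tends to
    \<open>\<mu> *\<^sub>C x\<close>, so closedness of the graph of \<open>A\<close>
    applies.\<close>
  have T_closed: "x \<in> D \<and> T x = 0" if "\<And>n. s n \<in> D" "s \<longlonglongrightarrow> x" "(\<lambda>n. T (s n)) \<longlonglongrightarrow> 0" for s x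
  proof -
    have "(\<lambda>n. T (s n) + \<mu> *\<^sub>C s n) \<longlonglongrightarrow> 0 + \<mu> *\<^sub>C x"
      using that by (intro tendsto_add bounded_linear.tendsto[OF bounded_linear_scaleC_right])
    then have lim: "(\<lambda>n. (s n, A (s n))) \<longlonglongrightarrow> (x, \<mu> *\<^sub>C x)"
      using that(2) by (intro tendsto_Pair) (simp_all add: T_def)
    have "(s n, A (s n)) \<in> {(x, A x) |x. x \<in> D}" for n
      using that(1) by blast
    then have "(x, \<mu> *\<^sub>C x) \<in> {(x, A x) |x. x \<in> D}"
      using lim by (rule closed_sequentially[OF clA])
    then show ?thesis by (auto simp: T_def)
  qed
  have co: "coercive_on T (D \<inter> M)"
    by (rule coercive_on_of_pos_type[OF lin T_def M(1,3)])
  let ?L = "eigenspace D A \<mu>"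
  have L_iff: "x \<in> ?L \<longleftrightarrow> x \<in> D \<and> T x = 0" for x
    unfolding eigenspace_def T_def by auto
  have L_sub: "csubspace ?L"
    using lin D linear_operator_zero[OF lin] unfolding linear_operator_def
    by (intro complex_vector.subspaceI)
      (auto simp: L_iff complex_vector.subspace_0 complex_vector.subspace_add complex_vector.subspace_scale)
  have L_closed: "closed ?L"
    unfolding closed_sequential_limits
  proof (intro allI impI)
    fix s x assume "(\<forall>n. s n \<in> ?L) \<and> s \<longlonglongrightarrow> x"
    then show "x \<in> ?L" using T_closed[of s x] by (simp add: L_iff)
  qed
  have L_pos: "qform x > 0" if "x \<in> ?L" "x \<in> M" "x \<noteq> 0" for x
  proof -
    obtain c d where cd: "d > 0" "\<And>x. x \<in> D \<inter> M \<Longrightarrow> d * (norm x)\<^sup>2 \<le> qform x + c * (norm (T x))\<^sup>2"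
      using co unfolding coercive_on_def by blast
    have "0 < d * (norm x)\<^sup>2" using cd(1) that(3) by simp
    also have "\<dots> \<le> qform x" using cd(2)[of x] that by (simp add: L_iff)
    finally show ?thesis .
  qed
  obtain N e g where b: "biorthogonal N e g" and eL: "\<And>i. i < N \<Longrightarrow> e i \<in> ?L"
    and Lpos: "\<And>x. \<lbrakk>x \<in> ?L; \<And>i. i < N \<Longrightarrow> form x (g i) = 0; x \<noteq> 0\<rbrakk> \<Longrightarrow> qform x > 0"
    and kap: "kappa_minus_zero G ?L = enat N"
    using finite_nonpositive_part[OF L_sub L_closed M(1,2) L_pos] by blast
  define F where "F = rank_op N g"
  define E where "E = {x \<in> D. \<forall>i<N. form x (g i) = 0}"
  have E_sub: "csubspace E"
    unfolding E_def using D by (intro complex_vector.subspaceI)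
      (auto simp: complex_vector.subspace_0 complex_vector.subspace_add
          complex_vector.subspace_scale form.zero_left form.add_left form_scaleC_left)
  have "coercive_on T E"
  proof (rule coercive_on_finite_extension[OF lin E_sub _ _ _ M(1,2)])
    show "E \<subseteq> D" by (auto simp: E_def)
    show "x \<in> E \<and> T x = 0" if s: "\<And>n. s n \<in> E" "s \<longlonglongrightarrow> x" "(\<lambda>n. T (s n)) \<longlonglongrightarrow> 0" for s x
    proof -
      have "form x (g i) = 0" if "i < N" for i
      proof (rule LIMSEQ_unique)
        show "(\<lambda>n. form (s n) (g i)) \<longlonglongrightarrow> form x (g i)"
          by (intro form.tendsto s(2) tendsto_const)
        show "(\<lambda>n. form (s n) (g i)) \<longlonglongrightarrow> 0" using s(1) that unfolding E_def by simp
      qed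
      moreover have "x \<in> D \<and> T x = 0" using T_closed[of s x] s unfolding E_def by blast
      ultimately show ?thesis unfolding E_def by blast
    qed
    show "qform x > 0" if "x \<in> E" "T x = 0" "x \<noteq> 0" for x
      using Lpos[of x] that unfolding E_def by (simp add: L_iff)
    show "coercive_on T (E \<inter> M)" using co unfolding coercive_on_def E_def by blast
  qed
  then obtain c d where cd: "d > 0" "\<And>x. x \<in> E \<Longrightarrow> d * (norm x)\<^sup>2 \<le> qform x + c * (norm (T x))\<^sup>2"
    unfolding coercive_on_def by blast
  have "pos_type_on G D (\<lambda>x. A x + F x) \<mu> UNIV"
    unfolding pos_type_on_def
  proof (intro allI impI)
    fix x assume "approx_eigenseq D (\<lambda>x. A x + F x) \<mu> x \<and> range x \<subseteq> UNIV"
    then have xD: "\<And>n. x n \<in> D" and x1: "\<And>n. norm (x n) = 1"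
      and lim: "(\<lambda>n. T (x n) + F (x n)) \<longlonglongrightarrow> 0"
      unfolding approx_eigenseq_def T_def by (auto simp: algebra_simps)
    have coeff: "(\<lambda>n. form (x n) (g i)) \<longlonglongrightarrow> 0" if i: "i < N" for i
    proof -
      \<comment> \<open>\<open>T (x n)\<close> is \<open>G\<close>-orthogonal to the kernel vector \<open>e i\<close>.\<close>
      have "form (T (x n) + F (x n)) (e i) = form (x n) (g i)" for n
        using T_sym[OF xD, of "e i" n] eL[OF i] rank_op_coeff[OF b i, of "x n"]
        by (simp add: L_iff form.add_left form.zero_right F_def)
      moreover have "(\<lambda>n. form (T (x n) + F (x n)) (e i)) \<longlonglongrightarrow> form 0 (e i)"
        by (intro form.tendsto lim tendsto_const)
      ultimately show ?thesis by (simp add: form.zero_left)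
    qed
    \<comment> \<open>Needed twice: with \<open>h = g\<close> it gives the convergence of
      \<open>F (x n)\<close> to 0, with \<open>h = e\<close> that of the correction
      \<open>r n\<close>.\<close>
    have sum0: "(\<lambda>n. \<Sum>i<N. form (x n) (g i) *\<^sub>C h i) \<longlonglongrightarrow> 0" for h :: "nat \<Rightarrow> 'a"
    proof -
      have "(\<lambda>n. \<Sum>i<N. form (x n) (g i) *\<^sub>C h i) \<longlonglongrightarrow> (\<Sum>i<N. 0 *\<^sub>C h i)"
        by (intro tendsto_sum bounded_linear.tendsto[OF bounded_linear_scaleC_left] coeff) simp
      then show ?thesis by simp
    qed
    have "(\<lambda>n. T (x n) + F (x n) - F (x n)) \<longlonglongrightarrow> 0 - 0"
      by (intro tendsto_diff lim) (simp add: F_def rank_op_def sum0)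
    then have Tx: "(\<lambda>n. T (x n)) \<longlonglongrightarrow> 0" by simp
    \<comment> \<open>Subtracting \<open>r n\<close> cancels the coordinates of \<open>x n\<close>
      and so lands in \<open>E\<close>; since \<open>r n\<close> is in the kernel, the value of
      \<open>T\<close> is unchanged.\<close>
    define r where "r n = (\<Sum>i<N. form (x n) (g i) *\<^sub>C e i)" for n
    have r: "r \<longlonglongrightarrow> 0" unfolding r_def[abs_def] by (rule sum0)
    have rL: "r n \<in> ?L" for n
      unfolding r_def using L_sub eL
      by (intro complex_vector.subspace_sum complex_vector.subspace_scale) auto
    define y where "y n = x n - r n" for n
    have "form (y n) (g i) = 0" if "i < N" for n i
      unfolding y_def r_def form.diff_left
      using biorthogonal_sum[OF b order_refl that] that by simp
    moreover have "y n \<in> D" for n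
      unfolding y_def using D xD rL by (auto simp: L_iff intro: complex_vector.subspace_diff)
    ultimately have yE: "y n \<in> E" for n unfolding E_def by blast
    have Ty: "T (y n) = T (x n)" for n
      using linear_operator_diff[OF lin xD, of "r n" n] rL[of n] unfolding y_def by (simp add: L_iff)
    obtain K where K: "K > 0" "\<And>x y. cmod (form x y) \<le> K * norm x * norm y"
      using form_bound by blast
    \<comment> \<open>The coercive estimate for \<open>y n\<close>, minus bounds for the terms that
      \<open>r n\<close> contributes to the form. All terms but the first vanish in the limit, and
      \<open>norm (y n)\<close> tends to 1, so \<open>l\<close> tends to \<open>d\<close>.\<close>
    define l where "l n = d * (norm (y n))\<^sup>2 - c * (norm (T (x n)))\<^sup>2
      - 2 * K * norm (y n) * norm (r n) - K * (norm (r n))\<^sup>2" for n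
    have le: "l n \<le> qform (x n)" for n
    proof -
      have "\<bar>Re (form (y n) (r n))\<bar> \<le> K * norm (y n) * norm (r n)"
        "\<bar>qform (r n)\<bar> \<le> K * (norm (r n))\<^sup>2"
        using K(2) abs_Re_le_cmod order_trans unfolding power2_eq_square mult.assoc by blast+
      moreover have "qform (x n) = qform (y n) + 2 * Re (form (y n) (r n)) + qform (r n)"
        using qform_add[of "y n" "r n"] by (simp add: y_def)
      ultimately show ?thesis using cd(2)[OF yE[of n]] Ty[of n] unfolding l_def by simp
    qed
    have ny: "(\<lambda>n. norm (y n)) \<longlonglongrightarrow> 1"
    proof (rule tendsto_sandwich)
      have "1 - norm (r n) \<le> norm (y n)" "norm (y n) \<le> 1 + norm (r n)" for n
        using norm_triangle_ineq2[of "x n" "r n"] norm_triangle_ineq4[of "x n" "r n"] x1[of n]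
        by (simp_all add: y_def)
      then show "\<forall>\<^sub>F n in sequentially. 1 - norm (r n) \<le> norm (y n)"
        "\<forall>\<^sub>F n in sequentially. norm (y n) \<le> 1 + norm (r n)"
        by (simp_all add: always_eventually)
      show "(\<lambda>n. 1 - norm (r n)) \<longlonglongrightarrow> 1" "(\<lambda>n. 1 + norm (r n)) \<longlonglongrightarrow> 1"
        using tendsto_diff[OF tendsto_const tendsto_norm[OF r], of 1]
          tendsto_add[OF tendsto_const tendsto_norm[OF r], of 1] by simp_all
    qed
    have "l \<longlonglongrightarrow> d * 1\<^sup>2 - c * (norm (0::'a))\<^sup>2 - 2 * K * 1 * norm (0::'a) - K * (norm (0::'a))\<^sup>2"
      unfolding l_def[abs_def] by (intro tendsto_intros ny Tx r)
    then have "liminf (\<lambda>n. ereal (l n)) = ereal d"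
      by (intro lim_imp_Liminf tendsto_ereal) simp_all
    moreover have "liminf (\<lambda>n. ereal (l n)) \<le> liminf (\<lambda>n. ereal (qform (x n)))"
      using le by (intro Liminf_mono always_eventually) simp
    ultimately show "0 < liminf (\<lambda>n. ereal (qform (x n)))"
      using cd(1) by (metis ereal_less(2) order_less_le_trans)
  qed
  moreover have rk: "cdim (range F) = enat N"
    unfolding F_def rank_op_range[OF b]
    using biorthogonal_cdim[OF biorthogonal_commute[OF b], of "{..<N}"] by simp
  ultimately show ?thesis
    using rank_op_bounded_clinear[of N g] rank_op_symmetric[of N g] kap
    unfolding F_def[symmetric] finite_rank_def by (intro exI[of _ F]) simp
qed

end

section \<open>Reversing the sign of the form\<close>

lemma gform_uminus: "gform (\<lambda>x. - G x) x y = - gform G x y"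
  by (simp add: gform_def cinner_minus_left)

lemma neg_type_on_uminus: "pos_type_on (\<lambda>x. - G x) D T \<mu> M \<longleftrightarrow> neg_type_on G D T \<mu> M"
proof -
  have "liminf (\<lambda>n. ereal (- r n)) > 0 \<longleftrightarrow> limsup (\<lambda>n. ereal (r n)) < 0" for r :: "nat \<Rightarrow> real"
    using ereal_Liminf_uminus[of sequentially "\<lambda>n. ereal (r n)"] by (simp add: ereal_uminus_less_reorder)
  then show ?thesis
    unfolding pos_type_on_def neg_type_on_def by (simp add: gform_uminus)
qed

lemma G_symmetric_uminus: "G_symmetric (\<lambda>x. - G x) D T \<longleftrightarrow> G_symmetric G D T"
  unfolding G_symmetric_def by (simp add: gform_uminus)

lemma isotropic_part_uminus: "isotropic_part (\<lambda>x. - G x) L = isotropic_part G L"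
  unfolding isotropic_part_def by (simp add: gform_uminus)

context bounded_form
begin

lemma bounded_form_uminus: "bounded_form (\<lambda>x. - G x)"
proof
  show "bounded_clinear (\<lambda>x. - G x)"
    using bounded unfolding bounded_clinear_def by (simp add: bounded_linear_minus)
  show "selfadjoint (\<lambda>x. - G x)"
    using self unfolding selfadjoint_def by (simp add: cinner_minus_left cinner_minus_right)
qed

lemma fundamental_decomposition_uminus_imp:
  assumes "fundamental_decomposition G L Lp Lm"
  shows "fundamental_decomposition (\<lambda>x. - G x) L Lm Lp"
proof -
  let ?L0 = "isotropic_part G L"
  obtain K where "positive_subspace G Lp" "negative_subspace G Lm"
    and orth: "G_orthogonal G Lp Lm" "G_orthogonal G Lp ?L0" "G_orthogonal G Lm ?L0"
    and L: "L = {u + v + w | u v w. u \<in> Lp \<and> v \<in> Lm \<and> w \<in> ?L0}"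
    and direct: "\<forall>u\<in>Lp. \<forall>v\<in>Lm. \<forall>w\<in>?L0. u + v + w = 0 \<longrightarrow> u = 0 \<and> v = 0 \<and> w = 0"
    and K: "\<forall>u\<in>Lp. \<forall>v\<in>Lm. \<forall>w\<in>?L0. norm u \<le> K * norm (u + v + w) \<and>
      norm v \<le> K * norm (u + v + w) \<and> norm w \<le> K * norm (u + v + w)"
    using assms unfolding fundamental_decomposition_def Let_def by (elim conjE exE)
  have "positive_subspace (\<lambda>x. - G x) Lm" "negative_subspace (\<lambda>x. - G x) Lp"
    using \<open>positive_subspace G Lp\<close> \<open>negative_subspace G Lm\<close>
    unfolding positive_subspace_def negative_subspace_def by (simp_all add: gform_uminus)
  moreover have "form x y = 0" if "x \<in> Lm" "y \<in> Lp" for x y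
    using orth(1) that form_commute[of x y] unfolding G_orthogonal_def by simp
  then have "G_orthogonal (\<lambda>x. - G x) Lm Lp" "G_orthogonal (\<lambda>x. - G x) Lm ?L0"
    "G_orthogonal (\<lambda>x. - G x) Lp ?L0"
    using orth unfolding G_orthogonal_def by (simp_all add: gform_uminus)
  moreover have swap: "v + u + w = u + v + w" for u v w :: 'a
    by (simp add: add.commute)
  have "L = {v + u + w | v u w. v \<in> Lm \<and> u \<in> Lp \<and> w \<in> ?L0}"
    by (subst L, intro Collect_cong) (metis swap)
  moreover have "\<forall>v\<in>Lm. \<forall>u\<in>Lp. \<forall>w\<in>?L0. v + u + w = 0 \<longrightarrow> v = 0 \<and> u = 0 \<and> w = 0"
    by (metis direct swap)
  moreover have "\<exists>K. \<forall>v\<in>Lm. \<forall>u\<in>Lp. \<forall>w\<in>?L0. norm v \<le> K * norm (v + u + w) \<and>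
      norm u \<le> K * norm (v + u + w) \<and> norm w \<le> K * norm (v + u + w)"
  proof (intro exI ballI)
    fix v u w assume "v \<in> Lm" "u \<in> Lp" "w \<in> ?L0"
    then show "norm v \<le> K * norm (v + u + w) \<and> norm u \<le> K * norm (v + u + w) \<and>
        norm w \<le> K * norm (v + u + w)"
      unfolding swap[of v u w] using K by blast
  qed
  ultimately show ?thesis
    unfolding fundamental_decomposition_def Let_def isotropic_part_uminus by (intro conjI)
qed

text \<open>Sign reversal is an involution, so the converse is the same implication for
  \<open>- G\<close>.\<close>

lemma fundamental_decomposition_uminus:
  "fundamental_decomposition (\<lambda>x. - G x) L Lm Lp \<longleftrightarrow> fundamental_decomposition G L Lp Lm"
proof
  interpret neg: bounded_form "\<lambda>x. - G x" by (rule bounded_form_uminus)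
  assume "fundamental_decomposition (\<lambda>x. - G x) L Lm Lp"
  from neg.fundamental_decomposition_uminus_imp[OF this]
  show "fundamental_decomposition G L Lp Lm" by simp
qed (rule fundamental_decomposition_uminus_imp)

lemma kappa_minus_zero_uminus: "kappa_minus_zero (\<lambda>x. - G x) L = kappa_plus_zero G L"
proof -
  have "kappa_minus (\<lambda>x. - G x) L = kappa_plus G L"
    unfolding kappa_minus_def kappa_plus_def fundamental_decomposition_uminus
    by (rule arg_cong[where f = The]) blast
  then show ?thesis
    unfolding kappa_minus_zero_def kappa_plus_zero_def kappa_zero_def isotropic_part_uminus by simp
qed

end

theorem theorem4p4:
  fixes G A :: "'a::complex_hilbert \<Rightarrow> 'a"
    and D :: "'a set"
    and \<mu> :: complex
  assumes G_bounded: "bounded_clinear G"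
    and G_selfadjoint: "selfadjoint G"
    and G_inj: "0 \<notin> sigma_p UNIV G"
    and A_closed: "closed_operator D A"
    and A_dense: "densely_defined D"
    and A_symmetric: "G_symmetric G D A"
  shows "(\<mu> \<in> sigma_pi_plus G D A \<inter> \<real> \<longrightarrow>
           (\<exists>F. bounded_clinear F \<and> finite_rank F \<and> G_symmetric G UNIV F \<and>
              \<mu> \<in> sigma_plus G D (\<lambda>x. A x + F x) \<union> reg_points D (\<lambda>x. A x + F x) \<and>
              cdim (range F) = kappa_minus_zero G (eigenspace D A \<mu>)))
       \<and> (\<mu> \<in> sigma_pi_minus G D A \<inter> \<real> \<longrightarrow>
           (\<exists>F. bounded_clinear F \<and> finite_rank F \<and> G_symmetric G UNIV F \<and>
              \<mu> \<in> sigma_minus G D (\<lambda>x. A x + F x) \<union> reg_points D (\<lambda>x. A x + F x) \<and>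
              cdim (range F) = kappa_plus_zero G (eigenspace D A \<mu>)))"
proof (intro conjI impI)
  interpret nondegenerate_form G
    using G_bounded G_selfadjoint G_inj by unfold_locales
  have "0 \<notin> sigma_p UNIV (\<lambda>x. - G x)"
    using G_inj unfolding sigma_p_def by simp
  then interpret neg: nondegenerate_form "\<lambda>x. - G x"
    using bounded_form_uminus by (simp add: nondegenerate_form_def nondegenerate_form_axioms_def)
  {
    assume "\<mu> \<in> sigma_pi_plus G D A \<inter> \<real>"
    then obtain M where "csubspace M" "finite_codim M" "pos_type_on G D A \<mu> M" and "\<mu> \<in> \<real>"
      unfolding sigma_pi_plus_def by blast
    from finite_rank_perturbation[OF A_closed A_symmetric this(4,1-3)]
    show "\<exists>F. bounded_clinear F \<and> finite_rank F \<and> G_symmetric G UNIV F \<and>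
              \<mu> \<in> sigma_plus G D (\<lambda>x. A x + F x) \<union> reg_points D (\<lambda>x. A x + F x) \<and>
              cdim (range F) = kappa_minus_zero G (eigenspace D A \<mu>)"
      unfolding sigma_plus_def reg_points_def by blast
  next
    assume "\<mu> \<in> sigma_pi_minus G D A \<inter> \<real>"
    then obtain M where "csubspace M" "finite_codim M" "neg_type_on G D A \<mu> M" and "\<mu> \<in> \<real>"
      unfolding sigma_pi_minus_def by blast
    \<comment> \<open>The positive case for \<open>- G\<close>: negative type becomes positive type,
      and the definite parts of the kernel change places.\<close>
    then have "\<exists>F. bounded_clinear F \<and> finite_rank F \<and> G_symmetric G UNIV F \<and>
        neg_type_on G D (\<lambda>x. A x + F x) \<mu> UNIV \<and>
        cdim (range F) = kappa_plus_zero G (eigenspace D A \<mu>)"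
      using neg.finite_rank_perturbation[OF A_closed, of \<mu> M] A_symmetric
      by (simp only: G_symmetric_uminus neg_type_on_uminus kappa_minus_zero_uminus)
    then show "\<exists>F. bounded_clinear F \<and> finite_rank F \<and> G_symmetric G UNIV F \<and>
              \<mu> \<in> sigma_minus G D (\<lambda>x. A x + F x) \<union> reg_points D (\<lambda>x. A x + F x) \<and>
              cdim (range F) = kappa_plus_zero G (eigenspace D A \<mu>)"
      unfolding sigma_minus_def reg_points_def by blast
  }
qed

end
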